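(* Up to row and column permutations, there is a unique irreducible limited $6\times4$ configuration attaining $z_2(6,4)=16$ displayed squares. A representative has rows labeled $A,B,C,D,E,F$ and columns $1,2,3,4$, one-edges $A1,A2,B1,B3,C1,C4,D2,D3,E2,E4,F3,F4$, and the four two-edges $$A3+B4,\qquad B2+F1,\qquad C2+E3,\qquad D4+E1$$ (the unoccupied cells being $A4,C3,D1,F2$). Here $A3$ denotes the cell in row $A$ and column $3$, etc., and $A3+B4$ denotes the two-edge $\{A3,B4\}$.
   Context: Fix $m,n\ge1$. Identify the cell $(i,j)$ (row $i$, column $j$) of the $m\times n$ grid with the monomial $u_{ij}=x_iy_j$ in real variables $x_i,y_j$. A bilinear form is a real linear combination of the $u_{ij}$. If $P$ is a sum of squares of real bilinear forms, $\mathrm{SOS}(P)$ is the least number of squares in such a representation. A one-edge is a single cell; a two-edge is an unordered pair of two distinct cells (possibly in a common row or column). An augmented configuration $G$ consists of a set $E_1$ of one-edges and a set $E_2$ of two-edges; it is simple if distinct selected edges have disjoint supports (sets of cells). Put $P_G=\sum_{(i,j)\in E_1}u_{ij}^2+\sum_{\{(i,j),(k,\ell)\}\in E_2}(u_{ij}+u_{k\ell})^2$ and $R(G)=|E_1|+|E_2|$ (number of displayed squares). $G$ is irreducible if $\mathrm{SOS}(P_G)=R(G)$. $z(m,n)$ is the maximum number of edges of a $C_4$-free bipartite graph with parts $[m]$ (rows) and $[n]$ (columns). $G$ is limited if it is simple, $E_1$ is $C_4$-free as a bipartite graph, and $|E_1|=z(m,n)$ (here $z(6,4)=12$). $z_2(m,n)$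 is the maximum of $R(G)$ over irreducible limited $m\times n$ configurations. Configurations are considered up to isomorphism: a row permutation together with a column permutation carrying one-edges to one-edges and two-edges to two-edges. *)

theory Defs
  imports Complex_Main "HOL-Library.Disjoint_Sets" "HOL-Combinatorics.Permutations"
begin

type_synonym cell = "nat \<times> nat"

definition cells :: "nat \<Rightarrow> nat \<Rightarrow> cell set" where
  "cells m n = {1..m} \<times> {1..n}"

subsection \<open>Bilinear forms and sums of squares\<close>

text \<open>
  Real polynomials in the variables \<open>x\<^sub>i, y\<^sub>j\<close> are represented by the functions they induce
  (faithfully, since the reals are infinite). The variables are indexed by all of \<open>nat\<close>;
  an \<open>m \<times> n\<close> form only involves \<open>x\<^sub>1, \<dots>, x\<^sub>m\<close> and \<open>y\<^sub>1, \<dots>, y\<^sub>n\<close>.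
\<close>

type_synonym form = "(nat \<Rightarrow> real) \<Rightarrow> (nat \<Rightarrow> real) \<Rightarrow> real"

definition u_mono :: "cell \<Rightarrow> form" where
  "u_mono c x y = x (fst c) * y (snd c)"

definition bilinear_form :: "nat \<Rightarrow> nat \<Rightarrow> form \<Rightarrow> bool" where
  "bilinear_form m n f \<longleftrightarrow> (\<exists>a. \<forall>x y. f x y = (\<Sum>c\<in>cells m n. a c * u_mono c x y))"

definition is_sos :: "nat \<Rightarrow> nat \<Rightarrow> form \<Rightarrow> nat \<Rightarrow> bool" where
  "is_sos m n P r \<longleftrightarrow>
     (\<exists>f. (\<forall>k<r. bilinear_form m n (f k)) \<and> (\<forall>x y. P x y = (\<Sum>k<r. (f k x y)\<^sup>2)))"

text \<open>Only meaningful if \<open>P\<close> is a sum of squares of bilinear forms.\<close>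

definition SOS :: "nat \<Rightarrow> nat \<Rightarrow> form \<Rightarrow> nat" where
  "SOS m n P = (LEAST r. is_sos m n P r)"

subsection \<open>Augmented configurations\<close>

record config =
  one_edges :: "cell set"
  two_edges :: "cell set set"

definition configuration :: "nat \<Rightarrow> nat \<Rightarrow> config \<Rightarrow> bool" where
  "configuration m n G \<longleftrightarrow>
     one_edges G \<subseteq> cells m n \<and> (\<forall>e\<in>two_edges G. e \<subseteq> cells m n \<and> card e = 2)"

text \<open>
  Distinct edges of a configuration have distinct supports, so it suffices that the set of all
  supports is a disjoint family.
\<close>

definition supports :: "config \<Rightarrow> cell set set" where
  "supports G = (\<lambda>c. {c}) ` one_edges G \<union> two_edges G"

definition simple_config :: "config \<Rightarrow> bool" where
  "simple_config G \<longleftrightarrow> disjoint (supports G)"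

definition P_config :: "config \<Rightarrow> form" where
  "P_config G x y = (\<Sum>c\<in>one_edges G. (u_mono c x y)\<^sup>2) + (\<Sum>e\<in>two_edges G. (\<Sum>c\<in>e. u_mono c x y)\<^sup>2)"

definition R_config :: "config \<Rightarrow> nat" where
  "R_config G = card (one_edges G) + card (two_edges G)"

definition irreducible_config :: "nat \<Rightarrow> nat \<Rightarrow> config \<Rightarrow> bool" where
  "irreducible_config m n G \<longleftrightarrow> configuration m n G \<and> SOS m n (P_config G) = R_config G"

definition C4_free :: "cell set \<Rightarrow> bool" where
  "C4_free E \<longleftrightarrow>
     \<not> (\<exists>i i' j j'. i \<noteq> i' \<and> j \<noteq> j' \<and> {(i, j), (i, j'), (i', j), (i', j')} \<subseteq> E)"

definition z_C4 :: "nat \<Rightarrow> nat \<Rightarrow> nat" where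
  "z_C4 m n = Max {card E | E. E \<subseteq> cells m n \<and> C4_free E}"

definition limited :: "nat \<Rightarrow> nat \<Rightarrow> config \<Rightarrow> bool" where
  "limited m n G \<longleftrightarrow> configuration m n G \<and> simple_config G \<and> C4_free (one_edges G) \<and>
     card (one_edges G) = z_C4 m n"

definition z2 :: "nat \<Rightarrow> nat \<Rightarrow> nat" where
  "z2 m n = Max {R_config G | G. irreducible_config m n G \<and> limited m n G}"

definition isomorphic :: "nat \<Rightarrow> nat \<Rightarrow> config \<Rightarrow> config \<Rightarrow> bool" where
  "isomorphic m n G H \<longleftrightarrow>
     (\<exists>\<pi> \<sigma>. \<pi> permutes {1..m} \<and> \<sigma> permutes {1..n} \<and>
        map_prod \<pi> \<sigma> ` one_edges G = one_edges H \<and>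
        (\<lambda>e. map_prod \<pi> \<sigma> ` e) ` two_edges G = two_edges H)"

definition unoccupied :: "nat \<Rightarrow> nat \<Rightarrow> config \<Rightarrow> cell set" where
  "unoccupied m n G = cells m n - \<Union> (supports G)"

text \<open>The rows labelled \<open>A, \<dots>, F\<close> are numbered \<open>1, \<dots>, 6\<close>.\<close>

definition G64 :: config where
  "G64 = \<lparr> one_edges = {(1, 1), (1, 2), (2, 1), (2, 3), (3, 1), (3, 4),
                         (4, 2), (4, 3), (5, 2), (5, 4), (6, 3), (6, 4)},
           two_edges = {{(1, 3), (2, 4)}, {(2, 2), (6, 1)}, {(3, 2), (5, 3)}, {(4, 4), (5, 1)}} \<rparr>"

end

theory Submission
  imports Defs
begin

text \<open>
  A \<open>C\<^sub>4\<close>-free set of 12 cells has two cells in each row, and the six rows realise the six pairs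
  of columns: the one-edges are the incidences of \<open>K\<^sub>4\<close>, with columns as vertices and rows as edges.

  A sum of \<open>r\<close> squares representing \<open>P\<^sub>G\<close> assigns to each cell a vector in \<open>\<real>\<^sup>r\<close>, and comparing
  coefficients fixes all inner products within a row or a column and the sum of the two diagonal inner
  products of every \<open>2 \<times> 2\<close> minor. For \<open>G64\<close> these relations force the 16 vectors of its
  displayed squares to be orthonormal, so \<open>r \<ge> 16\<close>.

  Conversely, reducibility is inherited from subconfigurations, and ten small subconfigurations have
  representations with fewer squares than displayed. Avoiding them leaves only two kinds of two-edges
  (\<open>row_edge\<close> and \<open>cross_edge\<close> below), at least one of the second kind occurs, and after relabelling
  it is \<open>A3 + B4\<close>. The two-edges compatible with \<open>A3 + B4\<close> form a graph on 14 vertices under pairwise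
  compatibility; its only triangle consists of the other three two-edges of \<open>G64\<close>.
\<close>

section \<open>Sums of squares and subconfigurations\<close>

definition lin_form :: "(real \<times> cell) list \<Rightarrow> form" where
  "lin_form l x y = (\<Sum>(c, p)\<leftarrow>l. c * u_mono p x y)"

lemma finite_cells [simp]: "finite (cells m n)"
  by (simp add: cells_def)

section \<open>Closure of bilinear forms under linear combinations\<close>

lemma bilinear_form_u_mono:
  assumes "p \<in> cells m n"
  shows "bilinear_form m n (\<lambda>x y. u_mono p x y)"
proof -
  have "u_mono p x y = (\<Sum>c\<in>cells m n. of_bool (c = p) * u_mono c x y)" for x y
    using assms by (simp add: sum.delta if_distrib[where f="\<lambda>t. t * _"] of_bool_def cong: if_cong)
  then show ?thesis
    unfolding bilinear_form_def by (intro exI[of _ "\<lambda>c. of_bool (c = p)"]) blast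
qed

lemma bilinear_form_add:
  assumes "bilinear_form m n f" "bilinear_form m n g"
  shows "bilinear_form m n (\<lambda>x y. f x y + g x y)"
proof -
  obtain a b where "\<forall>x y. f x y = (\<Sum>c\<in>cells m n. a c * u_mono c x y)"
    "\<forall>x y. g x y = (\<Sum>c\<in>cells m n. b c * u_mono c x y)"
    using assms unfolding bilinear_form_def by blast
  then show ?thesis
    unfolding bilinear_form_def
    by (intro exI[of _ "\<lambda>c. a c + b c"]) (simp add: sum.distrib distrib_right)
qed

lemma bilinear_form_scale:
  assumes "bilinear_form m n f"
  shows "bilinear_form m n (\<lambda>x y. k * f x y)"
proof -
  obtain a where "\<forall>x y. f x y = (\<Sum>c\<in>cells m n. a c * u_mono c x y)"
    using assms unfolding bilinear_form_def by blast
  then show ?thesis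
    unfolding bilinear_form_def
    by (intro exI[of _ "\<lambda>c. k * a c"]) (simp add: sum_distrib_left mult.assoc)
qed

lemma bilinear_form_zero: "bilinear_form m n (\<lambda>x y. 0)"
  unfolding bilinear_form_def by (intro exI[of _ "\<lambda>c. 0"]) simp

lemma bilinear_form_sum:
  assumes "finite A" "\<And>i. i \<in> A \<Longrightarrow> bilinear_form m n (f i)"
  shows "bilinear_form m n (\<lambda>x y. \<Sum>i\<in>A. f i x y)"
  using assms
  by (induction A rule: finite_induct) (simp_all add: bilinear_form_zero bilinear_form_add)

lemma bilinear_form_lin_form:
  assumes "snd ` set l \<subseteq> cells m n"
  shows "bilinear_form m n (lin_form l)"
  using assms
proof (induction l)
  case Nil
  then show ?case by (simp add: lin_form_def[abs_def] bilinear_form_zero)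
next
  case (Cons q l)
  have "lin_form (q # l) = (\<lambda>x y. fst q * u_mono (snd q) x y + lin_form l x y)"
    by (simp add: lin_form_def fun_eq_iff case_prod_beta)
  then show ?case
    using Cons by (simp add: bilinear_form_add bilinear_form_scale bilinear_form_u_mono)
qed

section \<open>Extending representations by further squares\<close>

lemma is_sos_zero: "is_sos m n (\<lambda>x y. 0) 0"
  by (simp add: is_sos_def)

text \<open>The weight is absorbed as \<open>sqrt w\<close>; weights spare the explicit
  representations nested roots.\<close>

lemma is_sos_add_square:
  assumes "is_sos m n P r" "bilinear_form m n f" "0 \<le> w"
  shows "is_sos m n (\<lambda>x y. w * (f x y)\<^sup>2 + P x y) (Suc r)"
proof -
  obtain g where g: "\<forall>k<r. bilinear_form m n (g k)" "\<forall>x y. P x y = (\<Sum>k<r. (g k x y)\<^sup>2)"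
    using assms(1) unfolding is_sos_def by blast
  show ?thesis
    unfolding is_sos_def
  proof (intro exI[of _ "g(r := \<lambda>x y. sqrt w * f x y)"] conjI allI impI)
    show "bilinear_form m n ((g(r := \<lambda>x y. sqrt w * f x y)) k)" if "k < Suc r" for k
      using that g(1) bilinear_form_scale[OF assms(2)] by (auto simp: less_Suc_eq)
  qed (use g(2) assms(3) in \<open>simp add: power_mult_distrib\<close>)
qed

lemma is_sos_weighted_list:
  assumes "is_sos m n P r"
    and "\<forall>(w, l) \<in> set fs. 0 \<le> w \<and> snd ` set l \<subseteq> cells m n"
  shows "is_sos m n (\<lambda>x y. (\<Sum>(w, l)\<leftarrow>fs. w * (lin_form l x y)\<^sup>2) + P x y) (length fs + r)"
  using assms(2)
proof (induction fs)
  case (Cons q fs)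
  obtain w l where q: "q = (w, l)"
    by (cases q)
  have "is_sos m n (\<lambda>x y. w * (lin_form l x y)\<^sup>2
      + ((\<Sum>(w, l)\<leftarrow>fs. w * (lin_form l x y)\<^sup>2) + P x y)) (Suc (length fs + r))"
    using Cons q by (intro is_sos_add_square bilinear_form_lin_form) simp_all
  then show ?case
    by (simp add: q add.assoc)
qed (simp add: assms(1))

lemma is_sos_sum_squares:
  assumes "finite A" "\<And>i. i \<in> A \<Longrightarrow> bilinear_form m n (f i)" "is_sos m n P r"
  shows "is_sos m n (\<lambda>x y. (\<Sum>i\<in>A. (f i x y)\<^sup>2) + P x y) (card A + r)"
  using assms(1,2)
proof (induction A rule: finite_induct)
  case (insert i A)
  then show ?case
    using is_sos_add_square[of m n "\<lambda>x y. (\<Sum>i\<in>A. (f i x y)\<^sup>2) + P x y" "card A + r" "f i" 1]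
    by (simp add: add.assoc)
qed (simp add: assms(3))

lemma configuration_finite:
  assumes "configuration m n G"
  shows "finite (one_edges G)" "finite (two_edges G)"
proof -
  show "finite (one_edges G)"
    using assms finite_subset unfolding configuration_def by fastforce
  have "two_edges G \<subseteq> Pow (cells m n)"
    using assms unfolding configuration_def by blast
  then show "finite (two_edges G)"
    by (rule finite_subset) simp
qed

text \<open>For \<open>P = 0\<close> this yields the displayed representation; otherwise
  \<open>P\<close> stands for a rewritten part of \<open>P_config G\<close>.\<close>

lemma is_sos_edge_squares:
  assumes "A \<subseteq> cells m n" "finite B" "\<forall>e\<in>B. e \<subseteq> cells m n" "is_sos m n P r"
  shows "is_sos m n (\<lambda>x y. (\<Sum>c\<in>A. (u_mono c x y)\<^sup>2) + ((\<Sum>e\<in>B. (\<Sum>c\<in>e. u_mono c x y)\<^sup>2) + P x y))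
    (card A + (card B + r))"
proof (intro is_sos_sum_squares assms(4))
  show "finite A" using assms(1) finite_subset by fastforce
  show "finite B" by (rule assms(2))
  show "bilinear_form m n (u_mono c)" if "c \<in> A" for c
    using that assms(1) bilinear_form_u_mono by blast
  show "bilinear_form m n (\<lambda>x y. \<Sum>c\<in>e. u_mono c x y)" if "e \<in> B" for e
  proof (rule bilinear_form_sum)
    show "finite e" using that assms(3) finite_subset by fastforce
    show "bilinear_form m n (u_mono c)" if "c \<in> e" for c
      using that \<open>e \<in> B\<close> assms(3) bilinear_form_u_mono by blast
  qed
qed

lemma is_sos_P_config:
  assumes "configuration m n G"
  shows "is_sos m n (P_config G) (R_config G)"
  using is_sos_edge_squares[OF _ configuration_finite(2)[OF assms] _ is_sos_zero] assms
  by (simp add: configuration_def P_config_def[abs_def] R_config_def)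

text \<open>A shorter list \<open>fs\<close> for the part \<open>(A, B)\<close>, joined with the
  untouched displayed squares, would represent \<open>P_config G\<close> with fewer than
  \<open>R_config G\<close> squares.\<close>

lemma reducible_subconfig:
  assumes irr: "irreducible_config m n G"
    and sub: "A \<subseteq> one_edges G" "B \<subseteq> two_edges G"
    and fs: "\<forall>(w, l) \<in> set fs. 0 \<le> w \<and> snd ` set l \<subseteq> A \<union> \<Union>B"
    and less: "length fs < card A + card B"
    and eq: "\<And>x y. (\<Sum>c\<in>A. (u_mono c x y)\<^sup>2) + (\<Sum>e\<in>B. (\<Sum>c\<in>e. u_mono c x y)\<^sup>2)
      = (\<Sum>(w, l)\<leftarrow>fs. w * (lin_form l x y)\<^sup>2)"
  shows False
proof -
  have conf: "configuration m n G" and SOS: "SOS m n (P_config G) = R_config G"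
    using irr by (auto simp: irreducible_config_def)
  note fin = configuration_finite[OF conf]
  have "A \<union> \<Union>B \<subseteq> cells m n"
    using conf sub unfolding configuration_def by blast
  with fs have fs': "\<forall>(w, l) \<in> set fs. 0 \<le> w \<and> snd ` set l \<subseteq> cells m n"
    unfolding case_prod_beta by (meson order_trans)
  have sos: "is_sos m n (\<lambda>x y. (\<Sum>c\<in>one_edges G - A. (u_mono c x y)\<^sup>2) +
      ((\<Sum>e\<in>two_edges G - B. (\<Sum>c\<in>e. u_mono c x y)\<^sup>2) + ((\<Sum>(w, l)\<leftarrow>fs. w * (lin_form l x y)\<^sup>2) + 0)))
    (card (one_edges G - A) + (card (two_edges G - B) + (length fs + 0)))"
    using conf fin fs'
    by (intro is_sos_edge_squares is_sos_weighted_list is_sos_zero) (fastforce simp: configuration_def)+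
  have "P_config G x y = (\<Sum>c\<in>one_edges G - A. (u_mono c x y)\<^sup>2) +
      ((\<Sum>e\<in>two_edges G - B. (\<Sum>c\<in>e. u_mono c x y)\<^sup>2) + ((\<Sum>(w, l)\<leftarrow>fs. w * (lin_form l x y)\<^sup>2) + 0))" for x y
    using eq[of x y] sum.subset_diff[OF sub(1) fin(1), of "\<lambda>c. (u_mono c x y)\<^sup>2"]
      sum.subset_diff[OF sub(2) fin(2), of "\<lambda>e. (\<Sum>c\<in>e. u_mono c x y)\<^sup>2"]
    by (simp add: P_config_def)
  then have "P_config G = (\<lambda>x y. (\<Sum>c\<in>one_edges G - A. (u_mono c x y)\<^sup>2) +
      ((\<Sum>e\<in>two_edges G - B. (\<Sum>c\<in>e. u_mono c x y)\<^sup>2) + ((\<Sum>(w, l)\<leftarrow>fs. w * (lin_form l x y)\<^sup>2) + 0)))"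
    by (intro ext)
  with sos have "is_sos m n (P_config G) (card (one_edges G - A) + (card (two_edges G - B) + (length fs + 0)))"
    by (simp only:)
  then have "R_config G \<le> card (one_edges G - A) + (card (two_edges G - B) + (length fs + 0))"
    using SOS Least_le unfolding SOS_def by metis
  moreover have "card (one_edges G - A) = card (one_edges G) - card A"
    "card (two_edges G - B) = card (two_edges G) - card B"
    "card A \<le> card (one_edges G)" "card B \<le> card (two_edges G)"
    using sub fin by (auto simp: card_Diff_subset finite_subset card_mono)
  ultimately show False
    using less by (simp add: R_config_def)
qed

section \<open>Reducible subconfigurations\<close>

text \<open>
  Each lemma below is named after the two-edges of the pattern, in the cell labels of the representative
  \<open>G64\<close>. The shorter representations come from choosing the free Gram parameters of the
  \<open>2 \<times> 2\<close> minors such that the Gram matrix becomes singular; this leads to \<open>h = 1/\<surd>2\<close>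
  and \<open>s = \<surd>3/2\<close>.
\<close>

lemma sqrt_half_obtain:
  obtains h :: real where "h * h = 1 / 2" "\<forall>z. h * (h * z) = z / 2" "1/2 \<le> h"
proof
  show h: "sqrt (1/2) * sqrt (1/2) = (1/2::real)"
    by (simp only: real_sqrt_mult_self)
  show "\<forall>z. sqrt (1/2) * (sqrt (1/2) * z) = z / 2"
    by (simp only: h mult.assoc[symmetric]) simp
  show "1/2 \<le> sqrt (1/2)" by (rule real_le_rsqrt) (simp add: power2_eq_square)
qed

lemma sqrt_three_quarters_obtain:
  obtains s :: real where "s * s = 3 / 4" "\<forall>z. s * (s * z) = 3 / 4 * z"
proof
  show s: "sqrt (3/4) * sqrt (3/4) = (3/4::real)"
    by (simp only: real_sqrt_mult_self)
  show "\<forall>z. sqrt (3/4) * (sqrt (3/4) * z) = 3/4 * z"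
    by (simp only: s mult.assoc[symmetric]) simp
qed

lemma reducible_A3B2:
  assumes irr: "irreducible_config m n G"
    and A: "{(p, a), (p, b), (q, a), (q, c)} \<subseteq> one_edges G"
    and B: "{{(p, c), (q, b)}} \<subseteq> two_edges G"
    and rows: "distinct [p, q]" and columns: "distinct [a, b, c]"
  shows False
proof -
  obtain s :: real where s: "s * s = 3 / 4" "\<forall>z. s * (s * z) = 3 / 4 * z"
    by (rule sqrt_three_quarters_obtain)
  \<comment> \<open>As \<open>s^2 + 1/4 = 1\<close>, \<open>(p, b)\<close> and \<open>(q, b)\<close>
    are each spread over two forms; the mixed terms on columns \<open>a\<close>, \<open>b\<close>
    cancel, and those on \<open>b\<close>, \<open>c\<close> add up to that of the two-edge.\<close>
  let ?fs = "[(1, [(1, (p, a)), (s, (q, b))]),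
      (1, [(1, (p, c)), (1/2, (q, b))]),
      (1, [(1, (q, a)), (- s, (p, b))]),
      (1, [(1, (q, c)), (1/2, (p, b))])]"
  show False
  proof (rule reducible_subconfig[OF irr A B, of ?fs], goal_cases)
    case 1
    show ?case using s by simp
  next
    case 2
    show ?case using rows columns by (simp add: doubleton_eq_iff)
  next
    case (3 x y)
    show ?case
      using rows columns
      by (simp add: lin_form_def u_mono_def doubleton_eq_iff power2_eq_square s)
        (simp add: algebra_simps s)
  qed
qed

lemma reducible_A3F1:
  assumes irr: "irreducible_config m n G"
    and A: "{(p, a), (q, a), (q, b), (r, b)} \<subseteq> one_edges G"
    and B: "{{(p, b), (r, a)}} \<subseteq> two_edges G"
    and rows: "distinct [p, q, r]" and columns: "distinct [a, b]"
  shows False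
proof -
  obtain s :: real where s: "s * s = 3 / 4" "\<forall>z. s * (s * z) = 3 / 4 * z"
    by (rule sqrt_three_quarters_obtain)
  \<comment> \<open>The pattern is that of \<open>reducible_A3B2\<close> with rows and columns
    exchanged, so the same coefficients serve.\<close>
  let ?fs = "[(1, [(1, (p, a)), (1/2, (r, b))]),
      (1, [(1, (q, a)), (s, (r, b))]),
      (1, [(1, (p, b)), (1/2, (r, a))]),
      (1, [(1, (q, b)), (- s, (r, a))])]"
  show False
  proof (rule reducible_subconfig[OF irr A B, of ?fs], goal_cases)
    case 1
    show ?case using s by simp
  next
    case 2
    show ?case using rows columns by (simp add: doubleton_eq_iff)
  next
    case (3 x y)
    show ?case
      using rows columns
      by (simp add: lin_form_def u_mono_def doubleton_eq_iff power2_eq_square s)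
        (simp add: algebra_simps s)
  qed
qed

lemma reducible_A3C3:
  assumes irr: "irreducible_config m n G"
    and A: "{(p, a), (r, a), (q, a), (q, b)} \<subseteq> one_edges G"
    and B: "{{(p, b), (r, b)}} \<subseteq> two_edges G"
    and rows: "distinct [p, q, r]" and columns: "distinct [a, b]"
  shows False
proof -
  obtain h :: real where h: "h * h = 1 / 2" "\<forall>z. h * (h * z) = z / 2" "1/2 \<le> h"
    by (rule sqrt_half_obtain)
  \<comment> \<open>As \<open>2*h^2 = 1\<close>, \<open>(q, b)\<close> is spread over two forms;
    \<open>- h\<close> at \<open>(q, a)\<close> cancels the mixed terms, and the weight
    \<open>1/2\<close> restores the square of \<open>(q, a)\<close>.\<close>
  let ?fs = "[(1, [(1, (p, a)), (h, (q, b))]),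
      (1, [(1, (r, a)), (h, (q, b))]),
      (1, [(1, (p, b)), (1, (r, b)), (- h, (q, a))]),
      (1/2, [(1, (q, a))])]"
  show False
  proof (rule reducible_subconfig[OF irr A B, of ?fs], goal_cases)
    case 1
    show ?case using h by simp
  next
    case 2
    show ?case using rows columns by (simp add: doubleton_eq_iff)
  next
    case (3 x y)
    show ?case
      using rows columns
      by (simp add: lin_form_def u_mono_def doubleton_eq_iff power2_eq_square h)
        (simp add: algebra_simps h)
  qed
qed

lemma reducible_A3A4_B2B4:
  assumes irr: "irreducible_config m n G"
    and A: "{(p, a), (p, b), (q, a), (q, c)} \<subseteq> one_edges G"
    and B: "{{(p, c), (p, d)}, {(q, b), (q, d)}} \<subseteq> two_edges G"
    and rows: "distinct [p, q]" and columns: "distinct [a, b, c, d]"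
  shows False
proof -
  obtain h :: real where h: "h * h = 1 / 2" "\<forall>z. h * (h * z) = z / 2" "1/2 \<le> h"
    by (rule sqrt_half_obtain)
  \<comment> \<open>Both \<open>(p, a)\<close> and \<open>(q, a)\<close> are spread over two forms,
    which saves two squares.\<close>
  let ?fs = "[(1, [(1, (q, b)), (1, (q, d)), (h, (p, a))]),
      (1, [(1, (q, c)), (h, (p, a))]),
      (1, [(1, (p, b)), (- h, (q, a))]),
      (1, [(1, (p, c)), (1, (p, d)), (- h, (q, a))])]"
  show False
  proof (rule reducible_subconfig[OF irr A B, of ?fs], goal_cases)
    case 1
    show ?case using h by simp
  next
    case 2
    show ?case using rows columns by (simp add: doubleton_eq_iff)
  next
    case (3 x y)
    show ?case
      using rows columns
      by (simp add: lin_form_def u_mono_def doubleton_eq_iff power2_eq_square h)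
        (simp add: algebra_simps h)
  qed
qed

lemma reducible_A3A4_B2C3:
  assumes irr: "irreducible_config m n G"
    and A: "{(p, a), (p, b), (q, a), (r, a), (r, d)} \<subseteq> one_edges G"
    and B: "{{(p, c), (p, d)}, {(q, b), (r, c)}} \<subseteq> two_edges G"
    and rows: "distinct [p, q, r]" and columns: "distinct [a, b, c, d]"
  shows False
proof -
  obtain h :: real where h: "h * h = 1 / 2" "\<forall>z. h * (h * z) = z / 2" "1/2 \<le> h"
    by (rule sqrt_half_obtain)
  let ?fs = "[(1, [(1, (q, b)), (1, (r, c)), (h, (p, a))]),
      (1, [(1, (r, d)), (h, (p, a))]),
      (1, [(1, (p, b)), (- h, (q, a))]),
      (1/2, [(1, (q, a))]),
      (1, [(1, (p, c)), (1, (p, d)), (- h, (r, a))]),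
      (1/2, [(1, (r, a))])]"
  show False
  proof (rule reducible_subconfig[OF irr A B, of ?fs], goal_cases)
    case 1
    show ?case using h by simp
  next
    case 2
    show ?case using rows columns by (simp add: doubleton_eq_iff)
  next
    case (3 x y)
    show ?case
      using rows columns
      by (simp add: lin_form_def u_mono_def doubleton_eq_iff power2_eq_square h)
        (simp add: algebra_simps h)
  qed
qed

lemma reducible_A3B4_A4B2:
  assumes irr: "irreducible_config m n G"
    and A: "{(p, a), (p, b), (q, a), (q, c)} \<subseteq> one_edges G"
    and B: "{{(p, c), (q, d)}, {(p, d), (q, b)}} \<subseteq> two_edges G"
    and rows: "distinct [p, q]" and columns: "distinct [a, b, c, d]"
  shows False
proof -
  obtain h :: real where h: "h * h = 1 / 2" "\<forall>z. h * (h * z) = z / 2" "1/2 \<le> h"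
    by (rule sqrt_half_obtain)
  \<comment> \<open>The coefficients \<open>h\<close> and \<open>1-h\<close> split the inner product
    of each two-edge between the diagonals of its minor; the weight is the rest
    \<open>1 - 2*(1-h)^2 = 4*h-2\<close> of the square of \<open>(p, d)\<close>.\<close>
  let ?fs = "[(1, [(1, (p, b)), (h, (q, d)), (h, (q, a))]),
      (1, [(1, (p, c)), (h, (q, d)), (- h, (q, a))]),
      (1, [(1, (q, b)), (- h, (p, a)), (1-h, (p, d))]),
      (1, [(1, (q, c)), (h, (p, a)), (1-h, (p, d))]),
      (4*h-2, [(1, (p, d))])]"
  show False
  proof (rule reducible_subconfig[OF irr A B, of ?fs], goal_cases)
    case 1
    show ?case using h by simp
  next
    case 2
    show ?case using rows columns by (simp add: doubleton_eq_iff)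
  next
    case (3 x y)
    show ?case
      using rows columns
      by (simp add: lin_form_def u_mono_def doubleton_eq_iff power2_eq_square h)
        (simp add: algebra_simps h)
  qed
qed

lemma reducible_A3B4_A4C3:
  assumes irr: "irreducible_config m n G"
    and A: "{(p, a), (q, a), (q, b), (r, a), (r, c)} \<subseteq> one_edges G"
    and B: "{{(p, b), (q, c)}, {(p, c), (r, b)}} \<subseteq> two_edges G"
    and rows: "distinct [p, q, r]" and columns: "distinct [a, b, c]"
  shows False
proof -
  obtain h :: real where h: "h * h = 1 / 2" "\<forall>z. h * (h * z) = z / 2" "1/2 \<le> h"
    by (rule sqrt_half_obtain)
  \<comment> \<open>The weights are \<open>h = 1 - (h-1/2)^2 - 1/4\<close>, the rest of the squares
    of \<open>(p, c)\<close> and \<open>(p, a)\<close>; the last form also corrects the square of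
    \<open>(p, b)\<close> and its mixed term with \<open>(p, a)\<close>.\<close>
  let ?fs = "[(1, [(1, (q, a)), (1, (r, b)), (h-1/2, (p, c))]),
      (1, [(1, (q, b)), (- 1, (r, a)), (1/2, (p, c))]),
      (1, [(1, (q, c)), (- (h-1/2), (p, a)), (1/2, (p, b))]),
      (1, [(1, (r, c)), (1/2, (p, a)), (3/2-h, (p, b))]),
      (h, [(1, (p, c))]),
      (h, [(1, (p, a)), (1-2*h, (p, b))])]"
  show False
  proof (rule reducible_subconfig[OF irr A B, of ?fs], goal_cases)
    case 1
    show ?case using h by simp
  next
    case 2
    show ?case using rows columns by (simp add: doubleton_eq_iff)
  next
    case (3 x y)
    show ?case
      using rows columns
      by (simp add: lin_form_def u_mono_def doubleton_eq_iff power2_eq_square h)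
        (simp add: algebra_simps h)
  qed
qed

lemma reducible_A3B4_A4D1:
  assumes irr: "irreducible_config m n G"
    and A: "{(q, a), (q, b), (r, b)} \<subseteq> one_edges G"
    and B: "{{(p, b), (q, c)}, {(p, c), (r, a)}} \<subseteq> two_edges G"
    and rows: "distinct [p, q, r]" and columns: "distinct [a, b, c]"
  shows False
proof -
  \<comment> \<open>Merging \<open>(q, b)\<close> with the second two-edge gives a mixed term with
    \<open>(p, c)\<close>, which is that of the first two-edge, and one with \<open>(r, a)\<close>,
    which cancels against the next form.\<close>
  let ?fs = "[(1, [(1, (p, c)), (1, (r, a)), (1, (q, b))]),
      (1, [(1, (q, a)), (- 1, (r, b))]),
      (1, [(1, (p, b))]),
      (1, [(1, (q, c))])]"
  show False
  proof (rule reducible_subconfig[OF irr A B, of ?fs], goal_cases)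
    case 1
    show ?case by simp
  next
    case 2
    show ?case using rows columns by (simp add: doubleton_eq_iff)
  next
    case (3 x y)
    show ?case
      using rows columns
      by (simp add: lin_form_def u_mono_def doubleton_eq_iff power2_eq_square)
        (simp add: algebra_simps)
  qed
qed

lemma reducible_A3B4_A4E3:
  assumes irr: "irreducible_config m n G"
    and A: "{(q, a), (r, b), (s, a), (s, b)} \<subseteq> one_edges G"
    and B: "{{(p, a), (q, b)}, {(p, b), (r, a)}} \<subseteq> two_edges G"
    and rows: "distinct [p, q, r, s]" and columns: "distinct [a, b]"
  shows False
proof -
  obtain h :: real where h: "h * h = 1 / 2" "\<forall>z. h * (h * z) = z / 2" "1/2 \<le> h"
    by (rule sqrt_half_obtain)
  \<comment> \<open>The pattern is the transpose of that in \<open>reducible_A3B4_A4B2\<close>, with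
    the same weight.\<close>
  let ?fs = "[(1, [(1, (q, b)), (h, (p, a)), (h, (s, a))]),
      (1, [(1, (r, b)), (h, (p, a)), (- h, (s, a))]),
      (1, [(1, (q, a)), (1-h, (p, b)), (- h, (s, b))]),
      (1, [(1, (r, a)), (1-h, (p, b)), (h, (s, b))]),
      (4*h-2, [(1, (p, b))])]"
  show False
  proof (rule reducible_subconfig[OF irr A B, of ?fs], goal_cases)
    case 1
    show ?case using h by simp
  next
    case 2
    show ?case using rows columns by (simp add: doubleton_eq_iff)
  next
    case (3 x y)
    show ?case
      using rows columns
      by (simp add: lin_form_def u_mono_def doubleton_eq_iff power2_eq_square h)
        (simp add: algebra_simps h)
  qed
qed

lemma reducible_A3B4_B2C3:
  assumes irr: "irreducible_config m n G"
    and A: "{(p, a), (p, b), (q, a), (r, a), (r, d)} \<subseteq> one_edges G"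
    and B: "{{(p, c), (q, d)}, {(q, b), (r, c)}} \<subseteq> two_edges G"
    and rows: "distinct [p, q, r]" and columns: "distinct [a, b, c, d]"
  shows False
proof -
  obtain h :: real where h: "h * h = 1 / 2" "\<forall>z. h * (h * z) = z / 2" "1/2 \<le> h"
    by (rule sqrt_half_obtain)
  \<comment> \<open>Here \<open>(q, a)\<close> is spread over two forms, while \<open>(p, a)\<close>
    and \<open>(r, a)\<close> get back half of their squares.\<close>
  let ?fs = "[(1, [(1, (q, b)), (1, (r, c)), (h, (p, a))]),
      (1/2, [(1, (p, a))]),
      (1, [(1, (p, b)), (- h, (q, a))]),
      (1, [(1, (r, d)), (h, (q, a))]),
      (1, [(1, (p, c)), (1, (q, d)), (- h, (r, a))]),
      (1/2, [(1, (r, a))])]"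
  show False
  proof (rule reducible_subconfig[OF irr A B, of ?fs], goal_cases)
    case 1
    show ?case using h by simp
  next
    case 2
    show ?case using rows columns by (simp add: doubleton_eq_iff)
  next
    case (3 x y)
    show ?case
      using rows columns
      by (simp add: lin_form_def u_mono_def doubleton_eq_iff power2_eq_square h)
        (simp add: algebra_simps h)
  qed
qed

section \<open>Gram vectors of a representation\<close>

text \<open>Bessel's inequality for the \<open>j\<close>-th standard basis vector bounds the squared
  \<open>j\<close>-th coordinates by 1 in total; summing over the \<open>r\<close> coordinates
  counts \<open>C\<close>.\<close>

lemma orthonormal_card_le:
  fixes a :: "nat \<Rightarrow> 'c \<Rightarrow> real"
  assumes "finite C" and orth: "\<And>c d. c \<in> C \<Longrightarrow> d \<in> C \<Longrightarrow> (\<Sum>k<r. a k c * a k d) = of_bool (c = d)"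
  shows "card C \<le> r"
proof -
  have "(\<Sum>c\<in>C. (a j c)\<^sup>2) \<le> 1" if j: "j < r" for j
  proof -
    have "(\<Sum>k<r. (\<Sum>c\<in>C. a j c * a k c)\<^sup>2) = (\<Sum>k<r. \<Sum>c\<in>C. \<Sum>d\<in>C. a j c * a j d * (a k c * a k d))"
      by (simp add: power2_eq_square sum_product mult_ac)
    also have "\<dots> = (\<Sum>c\<in>C. \<Sum>k<r. \<Sum>d\<in>C. a j c * a j d * (a k c * a k d))"
      by (rule sum.swap)
    also have "\<dots> = (\<Sum>c\<in>C. \<Sum>d\<in>C. \<Sum>k<r. a j c * a j d * (a k c * a k d))"
      by (intro sum.cong refl sum.swap)
    also have "\<dots> = (\<Sum>c\<in>C. \<Sum>d\<in>C. a j c * a j d * of_bool (c = d))"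
      by (intro sum.cong refl) (simp add: orth flip: sum_distrib_left)
    also have "\<dots> = (\<Sum>c\<in>C. (a j c)\<^sup>2)"
      using assms(1) by (intro sum.cong refl) (simp add: of_bool_def power2_eq_square if_distrib cong: if_cong)
    finally have sq: "(\<Sum>k<r. (\<Sum>c\<in>C. a j c * a k c)\<^sup>2) = (\<Sum>c\<in>C. (a j c)\<^sup>2)" .
    \<comment> \<open>This is the squared distance from the basis vector to its projection onto the
      span of the family.\<close>
    have "0 \<le> (\<Sum>k<r. (of_bool (k = j) - (\<Sum>c\<in>C. a j c * a k c))\<^sup>2)"
      by (simp add: sum_nonneg)
    also have "\<dots> = (\<Sum>k<r. (of_bool (k = j))\<^sup>2) - 2 * (\<Sum>k<r. of_bool (k = j) * (\<Sum>c\<in>C. a j c * a k c))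
        + (\<Sum>k<r. (\<Sum>c\<in>C. a j c * a k c)\<^sup>2)"
      by (simp add: power2_diff sum.distrib sum_subtractf sum_distrib_left mult.assoc)
    also have "\<dots> = 1 - (\<Sum>c\<in>C. (a j c)\<^sup>2)"
      using j unfolding sq by (simp add: of_bool_def if_distrib if_distribR power2_eq_square cong: if_cong)
    finally show ?thesis by simp
  qed
  then have "(\<Sum>j<r. \<Sum>c\<in>C. (a j c)\<^sup>2) \<le> (\<Sum>j<r. 1)"
    by (intro sum_mono) auto
  moreover have "(\<Sum>j<r. \<Sum>c\<in>C. (a j c)\<^sup>2) = (\<Sum>c\<in>C. \<Sum>j<r. a j c * a j c)"
    by (subst sum.swap) (simp add: power2_eq_square)
  moreover have "\<dots> = card C"
    by (simp add: orth)
  ultimately show ?thesis by simp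
qed

section \<open>Comparison of coefficients in quadratic forms of the cell monomials\<close>

definition quad_form :: "nat \<Rightarrow> nat \<Rightarrow> (cell \<Rightarrow> cell \<Rightarrow> real) \<Rightarrow> form" where
  "quad_form m n q x y = (\<Sum>c\<in>cells m n. \<Sum>d\<in>cells m n. q c d * (u_mono c x y * u_mono d x y))"

text \<open>Test points supported on two rows and two columns isolate a single minor.\<close>

lemma sum_cells_two_by_two:
  fixes f :: "cell \<Rightarrow> real"
  assumes "{i, k} \<subseteq> {1..m}" "i \<noteq> k" "{j, l} \<subseteq> {1..n}" "j \<noteq> l"
  shows "(\<Sum>c\<in>cells m n. f c * u_mono c ((\<lambda>_. 0)(i := 1, k := s)) ((\<lambda>_. 0)(j := 1, l := t)))
    = f (i, j) + t * f (i, l) + s * f (k, j) + s * t * f (k, l)"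
proof -
  have "(\<Sum>c\<in>cells m n. f c * u_mono c ((\<lambda>_. 0)(i := 1, k := s)) ((\<lambda>_. 0)(j := 1, l := t)))
      = (\<Sum>c\<in>{i, k} \<times> {j, l}. f c * u_mono c ((\<lambda>_. 0)(i := 1, k := s)) ((\<lambda>_. 0)(j := 1, l := t)))"
  proof (intro sum.mono_neutral_right ballI)
    show "{i, k} \<times> {j, l} \<subseteq> cells m n"
      using assms(1,3) unfolding cells_def by blast
    fix c
    assume "c \<in> cells m n - {i, k} \<times> {j, l}"
    then have "fst c \<notin> {i, k} \<or> snd c \<notin> {j, l}"
      by (cases c) auto
    then show "f c * u_mono c ((\<lambda>_. 0)(i := 1, k := s)) ((\<lambda>_. 0)(j := 1, l := t)) = 0"
      by (auto simp: u_mono_def)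
  qed simp
  also have "\<dots> = f (i, j) + t * f (i, l) + s * f (k, j) + s * t * f (k, l)"
  proof -
    have "{i, k} \<times> {j, l} = {(i, j), (i, l), (k, j), (k, l)}"
      by auto
    moreover have "k \<noteq> i" "l \<noteq> j"
      using assms(2,4) by auto
    ultimately show ?thesis
      using assms(2,4) by (simp add: u_mono_def)
  qed
  finally show ?thesis .
qed

text \<open>Both diagonals of a minor carry the same monomial, so only the sum of their coefficients
  is determined.\<close>

lemma quad_form_eq_0_coeffs:
  assumes comm: "\<And>c d. q c d = q d c" and zero: "\<And>x y. quad_form m n q x y = 0"
    and ik: "{i, k} \<subseteq> {1..m}" "i \<noteq> k" and jl: "{j, l} \<subseteq> {1..n}" "j \<noteq> l"
  shows "q (i, j) (i, j) = 0" "q (i, j) (i, l) = 0" "q (i, j) (k, j) = 0"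
    "q (i, j) (k, l) + q (i, l) (k, j) = 0"
proof -
  have eval: "(q (i, j) (i, j) + t * q (i, j) (i, l) + s * q (i, j) (k, j) + s * t * q (i, j) (k, l)) +
      t * (q (i, l) (i, j) + t * q (i, l) (i, l) + s * q (i, l) (k, j) + s * t * q (i, l) (k, l)) +
      s * (q (k, j) (i, j) + t * q (k, j) (i, l) + s * q (k, j) (k, j) + s * t * q (k, j) (k, l)) +
      s * t * (q (k, l) (i, j) + t * q (k, l) (i, l) + s * q (k, l) (k, j) + s * t * q (k, l) (k, l)) = 0"
    if "{i, k} \<subseteq> {1..m}" "i \<noteq> k" "{j, l} \<subseteq> {1..n}" "j \<noteq> l" for i j k l s t
  proof -
    let ?x = "(\<lambda>_. 0)(i := 1, k := s)" and ?y = "(\<lambda>_. 0)(j := 1, l := t)"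
    have "quad_form m n q ?x ?y
        = (\<Sum>c\<in>cells m n. (\<Sum>d\<in>cells m n. q c d * u_mono d ?x ?y) * u_mono c ?x ?y)"
      unfolding quad_form_def by (intro sum.cong refl) (simp add: sum_distrib_left mult_ac)
    also have "\<dots> = (\<Sum>c\<in>cells m n. (q c (i, j) + t * q c (i, l) + s * q c (k, j) + s * t * q c (k, l))
        * u_mono c ?x ?y)"
      by (simp only: sum_cells_two_by_two[OF that])
    also have "\<dots> = (q (i, j) (i, j) + t * q (i, j) (i, l) + s * q (i, j) (k, j) + s * t * q (i, j) (k, l)) +
      t * (q (i, l) (i, j) + t * q (i, l) (i, l) + s * q (i, l) (k, j) + s * t * q (i, l) (k, l)) +
      s * (q (k, j) (i, j) + t * q (k, j) (i, l) + s * q (k, j) (k, j) + s * t * q (k, j) (k, l)) +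
      s * t * (q (k, l) (i, j) + t * q (k, l) (i, l) + s * q (k, l) (k, j) + s * t * q (k, l) (k, l))"
      by (rule sum_cells_two_by_two[OF that])
    finally show ?thesis
      unfolding zero by (rule sym)
  qed
  have ki: "{k, i} \<subseteq> {1..m}" "k \<noteq> i" and lj: "{l, j} \<subseteq> {1..n}" "l \<noteq> j"
    using ik jl by auto
  \<comment> \<open>The values \<open>s = t = 0\<close> isolate a corner, one parameter equal to 1 a
    side, and \<open>s = t = 1\<close> then leaves the diagonals; exchanging \<open>i, k\<close> and
    \<open>j, l\<close> reaches every corner and side.\<close>
  have diag: "q (i, j) (i, j) = 0" "q (k, j) (k, j) = 0" "q (i, l) (i, l) = 0" "q (k, l) (k, l) = 0"
    using eval[OF ik jl, of 0 0] eval[OF ki jl, of 0 0] eval[OF ik lj, of 0 0] eval[OF ki lj, of 0 0]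
    by simp_all
  have line: "q (i, j) (i, l) = 0" "q (i, j) (k, j) = 0" "q (k, l) (k, j) = 0" "q (k, l) (i, l) = 0"
    using eval[OF ik jl, of 1 0] eval[OF ik jl, of 0 1] eval[OF ki lj, of 1 0] eval[OF ki lj, of 0 1]
      diag by (simp_all add: comm[of "(i, l)" "(i, j)"] comm[of "(k, j)" "(i, j)"] comm[of "(k, j)" "(k, l)"] comm[of "(i, l)" "(k, l)"])
  show "q (i, j) (i, j) = 0" "q (i, j) (i, l) = 0" "q (i, j) (k, j) = 0"
    using diag line by blast+
  show "q (i, j) (k, l) + q (i, l) (k, j) = 0"
    using eval[OF ik jl, of 1 1] diag line
    by (simp add: comm[of "(i, l)" "(i, j)"] comm[of "(k, j)" "(i, j)"] comm[of "(k, j)" "(k, l)"]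
      comm[of "(i, l)" "(k, l)"] comm[of "(k, l)" "(i, j)"] comm[of "(k, j)" "(i, l)"])
qed

text \<open>The Gram matrix of the displayed squares: each contributes the outer product of the
  indicator vector of its support.\<close>

definition gram_config :: "config \<Rightarrow> cell \<Rightarrow> cell \<Rightarrow> real" where
  "gram_config G c d = of_bool (c = d \<and> c \<in> one_edges G) + (\<Sum>e\<in>two_edges G. of_bool (c \<in> e) * of_bool (d \<in> e))"

lemma quad_form_add: "quad_form m n (\<lambda>c d. q c d + q' c d) x y = quad_form m n q x y + quad_form m n q' x y"
  by (simp add: quad_form_def distrib_right sum.distrib)

lemma quad_form_sum: "quad_form m n (\<lambda>c d. \<Sum>i\<in>A. q i c d) x y = (\<Sum>i\<in>A. quad_form m n (q i) x y)"
  unfolding quad_form_def sum_distrib_right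
  by (subst sum.swap[of _ A], subst sum.swap[of _ A]) (rule refl)

lemma quad_form_square:
  "quad_form m n (\<lambda>c d. v c * v d) x y = (\<Sum>c\<in>cells m n. v c * u_mono c x y)\<^sup>2"
  by (simp add: quad_form_def power2_eq_square sum_product mult_ac)

lemma quad_form_gram_config:
  assumes "configuration m n G"
  shows "quad_form m n (gram_config G) x y = P_config G x y"
proof -
  have sub: "one_edges G \<subseteq> cells m n" "\<And>e. e \<in> two_edges G \<Longrightarrow> e \<subseteq> cells m n"
    using assms by (auto simp: configuration_def)
  have "quad_form m n (\<lambda>c d. of_bool (c = d \<and> c \<in> one_edges G)) x y
      = (\<Sum>c\<in>cells m n. if c \<in> one_edges G then (u_mono c x y)\<^sup>2 else 0)"
    unfolding quad_form_def
    by (intro sum.cong refl) (auto simp: of_bool_def power2_eq_square if_distrib[where f = "\<lambda>t. t * _"] cong: if_cong)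
  also have "\<dots> = (\<Sum>c\<in>one_edges G. (u_mono c x y)\<^sup>2)"
    using sub(1) by (simp add: sum.If_cases Int_absorb1)
  finally have one: "quad_form m n (\<lambda>c d. of_bool (c = d \<and> c \<in> one_edges G)) x y
      = (\<Sum>c\<in>one_edges G. (u_mono c x y)\<^sup>2)" .
  have "(\<Sum>c\<in>cells m n. of_bool (c \<in> e) * u_mono c x y) = (\<Sum>c\<in>e. u_mono c x y)"
    if "e \<in> two_edges G" for e
    using sub(2)[OF that] by (simp add: of_bool_def if_distrib[where f = "\<lambda>t. t * _"] sum.If_cases Int_absorb1 cong: if_cong)
  then show ?thesis
    unfolding gram_config_def[abs_def] quad_form_add quad_form_sum quad_form_square one P_config_def by simp
qed

text \<open>The Gram matrices of any representation and of the displayed squares induce the same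
  form, so coefficients of their difference can be compared.\<close>

lemma is_sos_gram:
  assumes G: "configuration m n G" and sos: "is_sos m n (P_config G) r"
    and "2 \<le> m" "2 \<le> n"
  obtains a where
    "\<And>i j. (i, j) \<in> cells m n \<Longrightarrow>
      (\<Sum>p<r. a p (i, j) * a p (i, j)) = gram_config G (i, j) (i, j)"
    "\<And>i j l. (i, j) \<in> cells m n \<Longrightarrow> (i, l) \<in> cells m n \<Longrightarrow>
      (\<Sum>p<r. a p (i, j) * a p (i, l)) = gram_config G (i, j) (i, l)"
    "\<And>i j k. (i, j) \<in> cells m n \<Longrightarrow> (k, j) \<in> cells m n \<Longrightarrow>
      (\<Sum>p<r. a p (i, j) * a p (k, j)) = gram_config G (i, j) (k, j)"
    "\<And>i j k l. (i, j) \<in> cells m n \<Longrightarrow> (k, l) \<in> cells m n \<Longrightarrow> i \<noteq> k \<Longrightarrow> j \<noteq> l \<Longrightarrow>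
      (\<Sum>p<r. a p (i, j) * a p (k, l)) + (\<Sum>p<r. a p (i, l) * a p (k, j))
      = gram_config G (i, j) (k, l) + gram_config G (i, l) (k, j)"
proof -
  obtain f where f: "\<forall>p<r. bilinear_form m n (f p)" and P: "\<And>x y. P_config G x y = (\<Sum>p<r. (f p x y)\<^sup>2)"
    using sos unfolding is_sos_def by blast
  from f have "\<forall>p. \<exists>v. p < r \<longrightarrow> (\<forall>x y. f p x y = (\<Sum>c\<in>cells m n. v c * u_mono c x y))"
    unfolding bilinear_form_def by blast
  then obtain a where a: "\<And>p x y. p < r \<Longrightarrow> f p x y = (\<Sum>c\<in>cells m n. a p c * u_mono c x y)"
    by metis
  define q where "q c d = (\<Sum>p<r. a p c * a p d) + - 1 * gram_config G c d" for c d
  have "quad_form m n q x y = (\<Sum>p<r. (f p x y)\<^sup>2) - P_config G x y" for x y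
    unfolding q_def[abs_def] quad_form_add quad_form_sum quad_form_square
    by (simp add: a quad_form_gram_config[OF G, symmetric]) (simp add: quad_form_def sum_negf)
  then have zero: "quad_form m n q x y = 0" for x y
    by (simp add: P)
  have sym: "q c d = q d c" for c d
    by (auto simp: q_def gram_config_def mult.commute)
  \<comment> \<open>A further row or column completes a cell, or a pair within a line, to a
    minor.\<close>
  have other: "\<exists>k\<in>{1..N}. k \<noteq> i" if "2 \<le> N" for N i :: nat
    using that by (intro bexI[of _ "if i = 1 then 2 else 1"]) auto
  have diag: "q (i, j) (i, j) = 0" if "(i, j) \<in> cells m n" for i j
    using quad_form_eq_0_coeffs(1)[OF sym zero] other[OF assms(3), of i] other[OF assms(4), of j] that
    by (fastforce simp: cells_def)
  have row: "q (i, j) (i, l) = 0" if "(i, j) \<in> cells m n" "(i, l) \<in> cells m n" for i j l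
    using quad_form_eq_0_coeffs(2)[OF sym zero, of i _ j l] other[OF assms(3), of i] that diag
    by (cases "j = l") (fastforce simp: cells_def)+
  have column: "q (i, j) (k, j) = 0" if "(i, j) \<in> cells m n" "(k, j) \<in> cells m n" for i j k
    using quad_form_eq_0_coeffs(3)[OF sym zero, of i k j] other[OF assms(4), of j] that diag
    by (cases "i = k") (fastforce simp: cells_def)+
  have minor: "q (i, j) (k, l) + q (i, l) (k, j) = 0"
    if "(i, j) \<in> cells m n" "(k, l) \<in> cells m n" "i \<noteq> k" "j \<noteq> l" for i j k l
    using quad_form_eq_0_coeffs(4)[OF sym zero, of i k j l] that by (simp add: cells_def)
  show thesis
    by (rule that[of a]) (use diag row column minor in \<open>simp_all add: q_def algebra_simps\<close>)
qed

section \<open>Irreducibility of the representative\<close>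

lemma atLeastAtMost_numerals:
  "{1..6::nat} = {1, 2, 3, 4, 5, 6}" "{1..4::nat} = {1, 2, 3, 4}"
  by auto

lemma cells_64:
  "cells 6 4 = {1, 2, 3, 4, 5, 6} \<times> {1, 2, 3, 4}"
  by (simp only: cells_def atLeastAtMost_numerals)

lemma configuration_G64: "configuration 6 4 G64"
  by (simp add: configuration_def cells_64 G64_def)

lemma card_G64: "card (one_edges G64) = 12" "card (two_edges G64) = 4"
  by (simp_all add: G64_def doubleton_eq_iff)

lemma gram_config_G64:
  "gram_config G64 c d = of_bool (c = d \<and> c \<in> {(1, 1), (1, 2), (2, 1), (2, 3), (3, 1), (3, 4),
      (4, 2), (4, 3), (5, 2), (5, 4), (6, 3), (6, 4)}) +
    of_bool (c \<in> {(1, 3), (2, 4)} \<and> d \<in> {(1, 3), (2, 4)}) +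
    of_bool (c \<in> {(2, 2), (6, 1)} \<and> d \<in> {(2, 2), (6, 1)}) +
    of_bool (c \<in> {(3, 2), (5, 3)} \<and> d \<in> {(3, 2), (5, 3)}) +
    of_bool (c \<in> {(4, 4), (5, 1)} \<and> d \<in> {(4, 4), (5, 1)})"
  unfolding gram_config_def of_bool_conj[symmetric] by (simp add: G64_def doubleton_eq_iff)

text \<open>Unoccupied cells carry zero vectors, hence the two cells of each two-edge share one unit
  vector; with these identifications the remaining minors give orthogonality.\<close>

lemma is_sos_G64_ge:
  assumes "is_sos 6 4 (P_config G64) r"
  shows "16 \<le> r"
proof -
  note [simp del] = One_nat_def
  have le: "(2::nat) \<le> 6" "(2::nat) \<le> 4"
    by simp_all
  obtain a where
    diag: "\<And>i j. (i, j) \<in> cells 6 4 \<Longrightarrow>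
      (\<Sum>p<r. a p (i, j) * a p (i, j)) = gram_config G64 (i, j) (i, j)" and
    row: "\<And>i j l. (i, j) \<in> cells 6 4 \<Longrightarrow> (i, l) \<in> cells 6 4 \<Longrightarrow>
      (\<Sum>p<r. a p (i, j) * a p (i, l)) = gram_config G64 (i, j) (i, l)" and
    column: "\<And>i j k. (i, j) \<in> cells 6 4 \<Longrightarrow> (k, j) \<in> cells 6 4 \<Longrightarrow>
      (\<Sum>p<r. a p (i, j) * a p (k, j)) = gram_config G64 (i, j) (k, j)" and
    minor: "\<And>i j k l. (i, j) \<in> cells 6 4 \<Longrightarrow> (k, l) \<in> cells 6 4 \<Longrightarrow> i \<noteq> k \<Longrightarrow> j \<noteq> l \<Longrightarrow>
      (\<Sum>p<r. a p (i, j) * a p (k, l)) + (\<Sum>p<r. a p (i, l) * a p (k, j))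
      = gram_config G64 (i, j) (k, l) + gram_config G64 (i, l) (k, j)"
    by (rule is_sos_gram[OF configuration_G64 assms le]) blast
  define g where "g c d = (\<Sum>p<r. a p c * a p d)" for c d
  have sym: "g c d = g d c" for c d
    by (simp add: g_def mult.commute)
  have row: "g (i, j) (i, l) = gram_config G64 (i, j) (i, l)"
    if "i \<in> {1, 2, 3, 4, 5, 6}" "j \<in> {1, 2, 3, 4}" "l \<in> {1, 2, 3, 4}" for i j l
    unfolding g_def by (rule row)
      (use that in \<open>simp_all only: cells_64 mem_Times_iff fst_conv snd_conv not_False_eq_True\<close>)
  have column: "g (i, j) (k, j) = gram_config G64 (i, j) (k, j)"
    if "i \<in> {1, 2, 3, 4, 5, 6}" "k \<in> {1, 2, 3, 4, 5, 6}" "j \<in> {1, 2, 3, 4}" for i j k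
    unfolding g_def by (rule column)
      (use that in \<open>simp_all only: cells_64 mem_Times_iff fst_conv snd_conv not_False_eq_True\<close>)
  have minor: "g (i, j) (k, l) + g (i, l) (k, j) = gram_config G64 (i, j) (k, l) + gram_config G64 (i, l) (k, j)"
    if "i \<in> {1, 2, 3, 4, 5, 6}" "k \<in> {1, 2, 3, 4, 5, 6}"
      "j \<in> {1, 2, 3, 4}" "l \<in> {1, 2, 3, 4}" "i \<noteq> k" "j \<noteq> l" for i j k l
    unfolding g_def by (rule minor)
      (use that in \<open>simp_all only: cells_64 mem_Times_iff fst_conv snd_conv not_False_eq_True\<close>)
  \<comment> \<open>The hypothesis says that the difference of the two vectors has norm 0.\<close>
  have eq: "a p c = a p d" if "p < r" "g c c + g d d = 2 * g c d" for p c d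
  proof -
    have "(\<Sum>p<r. (a p c - a p d)\<^sup>2) = 0"
      using that(2) unfolding g_def power2_diff sum_subtractf sum.distrib mult.assoc sum_distrib_left[symmetric]
      by (simp add: power2_eq_square)
    then show ?thesis
      using that(1) by (simp add: sum_nonneg_eq_0_iff)
  qed
  have merge: "g c e = g d e" if "g c c + g d d = 2 * g c d" for c d e
    unfolding g_def[of _ e] by (intro sum.cong refl) (simp add: eq[OF _ that])
  have eq0: "a p c = 0" if "p < r" "g c c = 0" for p c
    using that by (simp add: g_def sum_nonneg_eq_0_iff)
  have zero: "g c d = 0" if "g c c = 0" for c d
    unfolding g_def by (simp add: eq0[OF _ that])
  have unocc: "g (1, 4) d = 0" "g (3, 3) d = 0" "g (4, 1) d = 0" "g (6, 2) d = 0" for d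
    using row[of 1 4 4] row[of 3 3 3] row[of 4 1 1] row[of 6 2 2] by (simp_all add: zero gram_config_G64)
  have unocc': "g d (1, 4) = 0" "g d (3, 3) = 0" "g d (4, 1) = 0" "g d (6, 2) = 0" for d
    using unocc[of d] by (simp_all only: sym[of d])
  have merge: "g d e = g c e" if "g c c = 1" "g d d = 1" "g c d = 1" for c d e
    by (rule merge[symmetric]) (simp add: that)
  have norm: "g (i, j) (i, j) = gram_config G64 (i, j) (i, j)"
    if "i \<in> {1, 2, 3, 4, 5, 6}" "j \<in> {1, 2, 3, 4}" for i j
    using row that by blast
  \<comment> \<open>The other diagonal of the minor spanned by a two-edge of \<open>G64\<close> has an unoccupied cell, so the
    two unit vectors of the two-edge have inner product 1 and coincide.\<close>
  have two: "g (2, 4) d = g (1, 3) d" "g (6, 1) d = g (2, 2) d" "g (5, 3) d = g (3, 2) d" "g (5, 1) d = g (4, 4) d" for d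
  proof (rule_tac [!] merge)
    show "g (1, 3) (2, 4) = 1" "g (2, 2) (6, 1) = 1" "g (3, 2) (5, 3) = 1" "g (4, 4) (5, 1) = 1"
      using minor[of 1 2 3 4] minor[of 2 6 2 1] minor[of 3 5 2 3] minor[of 4 5 4 1]
      by (simp_all add: gram_config_G64 unocc unocc')
  qed (simp_all add: norm gram_config_G64)
  have two': "g d (2, 4) = g d (1, 3)" "g d (6, 1) = g d (2, 2)" "g d (5, 3) = g d (3, 2)" "g d (5, 1) = g d (4, 4)" for d
    using two[of d] by (simp_all only: sym[of d])
  note reduce = two two' unocc unocc'
  have line: "g (i, j) (k, l) = gram_config G64 (i, j) (k, l)"
    if "i = k \<or> j = l" "i \<in> {1, 2, 3, 4, 5, 6}" "j \<in> {1, 2, 3, 4}" "k \<in> {1, 2, 3, 4, 5, 6}" "l \<in> {1, 2, 3, 4}" for i j k l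
    using that(1)
  proof
    assume "i = k"
    then show ?thesis using row[OF that(2,3,5)] by (simp only:)
  next
    assume "j = l"
    then show ?thesis using column[OF that(2,4,3)] by (simp only:)
  qed
  have minors: "\<forall>i\<in>{1, 2, 3, 4, 5, 6}. \<forall>j\<in>{1, 2, 3, 4}. \<forall>k\<in>{1, 2, 3, 4, 5, 6}. \<forall>l\<in>{1, 2, 3, 4}.
     i < k \<longrightarrow> j < l \<longrightarrow> g (i, j) (k, l) + g (i, l) (k, j) = gram_config G64 (i, j) (k, l) + gram_config G64 (i, l) (k, j)"
    by (intro ballI impI, rule minor) (assumption | erule less_imp_neq)+
  \<comment> \<open>One cell for each displayed square.\<close>
  let ?C = "{(1, 1), (1, 2), (2, 1), (2, 3), (3, 1), (3, 4), (4, 2), (4, 3), (5, 2), (5, 4), (6, 3), (6, 4),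
    (1, 3), (2, 2), (3, 2), (4, 4)} :: cell set"
  have "card ?C \<le> r"
  proof (rule orthonormal_card_le[where a = a])
    \<comment> \<open>The omitted cell of each two-edge has the vector of the chosen one, so its row
      and column relations constrain the chosen cell as well.\<close>
    have "\<forall>(i, j)\<in>{(2, 4), (6, 1), (5, 3), (5, 1)}.
        (\<forall>l\<in>{1, 2, 3, 4}. g (i, j) (i, l) = gram_config G64 (i, j) (i, l)) \<and>
        (\<forall>k\<in>{1, 2, 3, 4, 5, 6}. g (i, j) (k, j) = gram_config G64 (i, j) (k, j))"
      by (simp add: line)
    then have orth: "\<forall>c\<in>?C. \<forall>d\<in>?C. g c d = of_bool (c = d)"
      using minors by (simp add: line gram_config_G64 reduce sym)
    show "(\<Sum>k<r. a k c * a k d) = of_bool (c = d)" if "c \<in> ?C" "d \<in> ?C" for c d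
      using bspec[OF bspec[OF orth that(1)] that(2)] unfolding g_def .
  qed simp
  then show ?thesis
    by simp
qed

lemma SOS_G64: "SOS 6 4 (P_config G64) = R_config G64"
  unfolding SOS_def
proof (rule Least_equality)
  show "is_sos 6 4 (P_config G64) (R_config G64)"
    by (rule is_sos_P_config[OF configuration_G64])
  show "R_config G64 \<le> r" if "is_sos 6 4 (P_config G64) r" for r
    using is_sos_G64_ge[OF that] by (simp add: R_config_def card_G64)
qed

lemma irreducible_G64: "irreducible_config 6 4 G64"
  by (simp add: irreducible_config_def configuration_G64 SOS_G64)

lemma simple_G64: "simple_config G64"
  by (simp add: simple_config_def supports_def G64_def disjoint_def doubleton_eq_iff)

text \<open>Quantifiers bounded by \<open>E\<close> can be evaluated on an explicit set.\<close>

lemma C4_free_iff: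
  "C4_free E \<longleftrightarrow> (\<forall>p\<in>E. \<forall>q\<in>E. fst p \<noteq> fst q \<and> snd p \<noteq> snd q \<longrightarrow> (fst p, snd q) \<notin> E \<or> (fst q, snd p) \<notin> E)"
  unfolding C4_free_def by fastforce

lemma C4_free_G64: "C4_free (one_edges G64)"
  unfolding C4_free_iff by (simp add: G64_def)

lemma unoccupied_G64: "unoccupied 6 4 G64 = {(1, 4), (3, 3), (4, 1), (6, 2)}"
  by (simp add: unoccupied_def supports_def cells_64 G64_def insert_Diff_if)

section \<open>Compatible two-edges\<close>

text \<open>The pairs \<open>12, 13, 14, 23, 24, 34\<close> of columns are numbered by the rows \<open>1, \<dots>, 6\<close>, as in \<open>G64\<close>.\<close>

definition std_row :: "nat \<Rightarrow> nat \<Rightarrow> nat" where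
  "std_row a b = (if min a b = 1 then max a b - 1 else if min a b = 2 then max a b + 1 else 6)"

definition all_columns :: "nat \<Rightarrow> nat \<Rightarrow> nat \<Rightarrow> nat \<Rightarrow> bool" where
  "all_columns a b c d \<longleftrightarrow> distinct [a, b, c, d] \<and> {a, b, c, d} = {1..4}"

text \<open>In terms of \<open>K\<^sub>4\<close>, \<open>r a b\<close> is the row of the edge joining the columns \<open>a\<close> and \<open>b\<close>.\<close>

definition row_edge :: "(nat \<Rightarrow> nat \<Rightarrow> nat) \<Rightarrow> nat \<Rightarrow> nat \<Rightarrow> nat \<Rightarrow> nat \<Rightarrow> cell set" where
  "row_edge r a b c d = {(r a b, c), (r a b, d)}"

text \<open>For \<open>std_row\<close> and the columns 1, 2, 3, 4 in order this is
  \<open>A3 + B4\<close>, while \<open>row_edge\<close> is \<open>A3 + A4\<close>.\<close>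

definition cross_edge :: "(nat \<Rightarrow> nat \<Rightarrow> nat) \<Rightarrow> nat \<Rightarrow> nat \<Rightarrow> nat \<Rightarrow> nat \<Rightarrow> cell set" where
  "cross_edge r a b c d = {(r a b, c), (r a c, d)}"

definition column_perms :: "(nat \<times> nat \<times> nat \<times> nat) set" where
  "column_perms = {(1,2,3,4),(1,2,4,3),(1,3,2,4),(1,3,4,2),(1,4,2,3),(1,4,3,2),
    (2,1,3,4),(2,1,4,3),(2,3,1,4),(2,3,4,1),(2,4,1,3),(2,4,3,1),
    (3,1,2,4),(3,1,4,2),(3,2,1,4),(3,2,4,1),(3,4,1,2),(3,4,2,1),
    (4,1,2,3),(4,1,3,2),(4,2,1,3),(4,2,3,1),(4,3,1,2),(4,3,2,1)}"

lemma all_columns_iff: "all_columns a b c d \<longleftrightarrow> (a, b, c, d) \<in> column_perms"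
proof
  assume "(a, b, c, d) \<in> column_perms"
  moreover have "{1..4::nat} = {1, 2, 3, 4}"
    by auto
  ultimately show "all_columns a b c d"
    unfolding column_perms_def by (elim insertE emptyE) (simp_all add: all_columns_def insert_commute)
next
  assume *: "all_columns a b c d"
  have enum: "\<forall>a\<in>{1, 2, 3, 4}. \<forall>b\<in>{1, 2, 3, 4}. a \<noteq> b \<longrightarrow> (\<forall>c\<in>{1, 2, 3, 4}. c \<noteq> a \<longrightarrow> c \<noteq> b \<longrightarrow>
      (\<forall>d\<in>{1, 2, 3, 4}. d \<noteq> a \<longrightarrow> d \<noteq> b \<longrightarrow> d \<noteq> c \<longrightarrow> (a, b, c, d) \<in> column_perms))"
    by (simp add: column_perms_def)
  have "{1..4::nat} = {1, 2, 3, 4}"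
    by auto
  then have eq: "{a, b, c, d} = {1, 2, 3, 4}"
    using * by (simp only: all_columns_def)
  have mem: "a \<in> {1, 2, 3, 4}" "b \<in> {1, 2, 3, 4}" "c \<in> {1, 2, 3, 4}" "d \<in> {1, 2, 3, 4}"
    unfolding eq[symmetric] by simp_all
  have neq: "a \<noteq> b" "c \<noteq> a" "c \<noteq> b" "d \<noteq> a" "d \<noteq> b" "d \<noteq> c"
    using * by (simp_all add: all_columns_def eq_commute)
  show "(a, b, c, d) \<in> column_perms"
    by (rule enum[rule_format]) (rule mem neq)+
qed

text \<open>The combinatorial core, for an abstract \<open>K\<close> so that two-edges transported
  to the standard labelling can be inserted; the named hypotheses are the reducible pairs in all
  column relabellings.\<close>

lemma two_edges_unique:
  assumes e0: "{(1, 3), (2, 4)} \<in> K"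
    and disj: "\<And>e f. e \<in> K \<Longrightarrow> f \<in> K \<Longrightarrow> e \<noteq> f \<Longrightarrow> e \<inter> f = {}"
    and form: "\<And>e. e \<in> K \<Longrightarrow>
      \<exists>a b c d. all_columns a b c d \<and> (e = row_edge std_row a b c d \<or> e = cross_edge std_row a b c d)"
    and A3A4_B2B4: "\<And>a b c d. all_columns a b c d \<Longrightarrow>
      row_edge std_row a b c d \<in> K \<Longrightarrow> row_edge std_row a c b d \<notin> K"
    and A3A4_B2C3: "\<And>a b c d. all_columns a b c d \<Longrightarrow>
      row_edge std_row a b c d \<in> K \<Longrightarrow> {(std_row a c, b), (std_row a d, c)} \<notin> K"
    and A3B4_A4B2: "\<And>a b c d. all_columns a b c d \<Longrightarrow>
      cross_edge std_row a b c d \<in> K \<Longrightarrow> {(std_row a b, d), (std_row a c, b)} \<notin> K"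
    and A3B4_A4C3: "\<And>a b c d. all_columns a b c d \<Longrightarrow>
      cross_edge std_row a b c d \<in> K \<Longrightarrow> {(std_row a b, d), (std_row a d, c)} \<notin> K"
    and A3B4_A4D1: "\<And>a b c d. all_columns a b c d \<Longrightarrow>
      cross_edge std_row a b c d \<in> K \<Longrightarrow> {(std_row a b, d), (std_row b c, a)} \<notin> K"
    and A3B4_A4E3: "\<And>a b c d. all_columns a b c d \<Longrightarrow>
      cross_edge std_row a b c d \<in> K \<Longrightarrow> {(std_row a b, d), (std_row b d, c)} \<notin> K"
    and A3B4_B2C3: "\<And>a b c d. all_columns a b c d \<Longrightarrow>
      cross_edge std_row a b c d \<in> K \<Longrightarrow> {(std_row a c, b), (std_row a d, c)} \<notin> K"
    and card: "4 \<le> card K"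
  shows "K = {{(1, 3), (2, 4)}, {(2, 2), (6, 1)}, {(3, 2), (5, 3)}, {(4, 4), (5, 1)}}"
proof -
  note [simp del] = One_nat_def
  have r: "std_row 1 2 = 1" "std_row 2 1 = 1" "std_row 1 3 = 2" "std_row 3 1 = 2" "std_row 1 4 = 3" "std_row 4 1 = 3"
    "std_row 2 3 = 4" "std_row 3 2 = 4" "std_row 2 4 = 5" "std_row 4 2 = 5" "std_row 3 4 = 6" "std_row 4 3 = 6"
    by (simp_all add: std_row_def)
  note eval = r row_edge_def cross_edge_def insert_commute all_columns_iff column_perms_def
  \<comment> \<open>These are the pairs of disjoint candidates from the list \<open>?L\<close> below
    that a reducible pattern forbids.\<close>
  have compat1:
    "{(2, 2), (6, 1)} \<in> K \<Longrightarrow> {(3, 3), (6, 2)} \<notin> K"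
    "{(2, 2), (6, 1)} \<in> K \<Longrightarrow> {(4, 1), (4, 4)} \<notin> K"
    "{(2, 2), (6, 1)} \<in> K \<Longrightarrow> {(4, 1), (6, 2)} \<notin> K"
    "{(3, 2), (5, 3)} \<in> K \<Longrightarrow> {(3, 3), (5, 1)} \<notin> K"
    using A3B4_A4D1[of 3 4 1 2] A3A4_B2C3[of 3 2 1 4] A3B4_A4C3[of 3 4 1 2] A3B4_A4B2[of 4 1 2 3]
    by (simp_all add: eval) blast+
  have compat2:
    "{(3, 2), (5, 3)} \<in> K \<Longrightarrow> {(3, 3), (6, 2)} \<notin> K"
    "{(3, 2), (5, 3)} \<in> K \<Longrightarrow> {(5, 1), (6, 2)} \<notin> K"
    "{(3, 2), (5, 3)} \<in> K \<Longrightarrow> {(6, 1), (6, 2)} \<notin> K"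
    "{(3, 2), (6, 1)} \<in> K \<Longrightarrow> {(3, 3), (5, 1)} \<notin> K"
    using A3B4_A4C3[of 4 1 2 3] A3B4_B2C3[of 4 1 2 3] A3A4_B2C3[of 4 3 2 1] A3B4_B2C3[of 4 3 1 2]
    by (simp_all add: eval) blast+
  have compat3:
    "{(3, 2), (6, 1)} \<in> K \<Longrightarrow> {(3, 3), (6, 2)} \<notin> K"
    "{(3, 2), (6, 1)} \<in> K \<Longrightarrow> {(5, 1), (5, 3)} \<notin> K"
    "{(3, 2), (6, 1)} \<in> K \<Longrightarrow> {(5, 1), (6, 2)} \<notin> K"
    "{(3, 3), (5, 1)} \<in> K \<Longrightarrow> {(4, 1), (5, 3)} \<notin> K"
    using A3B4_A4B2[of 4 3 1 2] A3A4_B2C3[of 4 2 1 3] A3B4_A4C3[of 4 3 1 2] A3B4_A4E3[of 4 2 1 3]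
    by (simp_all add: eval) blast+
  have compat4:
    "{(3, 3), (5, 1)} \<in> K \<Longrightarrow> {(5, 3), (6, 1)} \<notin> K"
    "{(3, 3), (6, 2)} \<in> K \<Longrightarrow> {(5, 1), (5, 3)} \<notin> K"
    "{(3, 3), (6, 2)} \<in> K \<Longrightarrow> {(5, 3), (6, 1)} \<notin> K"
    "{(4, 1), (5, 3)} \<in> K \<Longrightarrow> {(4, 4), (5, 1)} \<notin> K"
    using A3B4_A4C3[of 4 2 1 3] A3A4_B2C3[of 4 2 3 1] A3B4_B2C3[of 4 1 3 2] A3B4_A4B2[of 2 4 3 1]
    by (simp_all add: eval) blast+
  have compat5:
    "{(4, 1), (5, 3)} \<in> K \<Longrightarrow> {(4, 4), (6, 1)} \<notin> K"
    "{(4, 1), (5, 3)} \<in> K \<Longrightarrow> {(5, 1), (6, 2)} \<notin> K"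
    "{(4, 1), (6, 2)} \<in> K \<Longrightarrow> {(4, 4), (5, 1)} \<notin> K"
    "{(4, 1), (6, 2)} \<in> K \<Longrightarrow> {(4, 4), (6, 1)} \<notin> K"
    using A3B4_A4D1[of 3 2 4 1] A3B4_A4D1[of 2 4 3 1] A3B4_A4D1[of 2 3 4 1] A3B4_A4B2[of 3 4 2 1]
    by (simp_all add: eval) blast+
  have compat6:
    "{(5, 1), (6, 2)} \<in> K \<Longrightarrow> {(5, 3), (6, 1)} \<notin> K"
    "{(4, 1), (4, 4)} \<in> K \<Longrightarrow> {(6, 1), (6, 2)} \<notin> K"
    using A3B4_A4B2[of 4 3 2 1] A3A4_B2B4[of 3 2 4 1]
    by (simp_all add: eval)
  note compat = compat1 compat2 compat3 compat4 compat5 compat6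
  \<comment> \<open>These two-edges are disjoint from \<open>A3 + B4\<close> but forbidden by
    it.\<close>
  have ex:
    "{(1, 4), (2, 2)} \<notin> K"
    "{(1, 4), (3, 3)} \<notin> K"
    "{(1, 4), (4, 1)} \<notin> K"
    "{(1, 4), (5, 3)} \<notin> K"
    "{(2, 2), (3, 3)} \<notin> K"
    "{(2, 2), (4, 4)} \<notin> K"
    "{(3, 2), (3, 3)} \<notin> K"
    using A3B4_A4B2[of 1 2 3 4] A3B4_A4C3[of 1 2 3 4] A3B4_A4D1[of 1 2 3 4] A3B4_A4E3[of 1 2 3 4]
      A3B4_B2C3[of 1 2 3 4] A3B4_A4D1[of 3 1 2 4] A3A4_B2C3[of 1 4 3 2] e0
    by (simp_all add: eval) blast+
  \<comment> \<open>Of the 30 two-edges of the two kinds, nine meet \<open>A3 + B4\<close> (itself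
    included) and seven are excluded by \<open>ex\<close>.\<close>
  let ?L = "{{(2, 2), (6, 1)},
      {(3, 2), (5, 3)},
      {(3, 2), (6, 1)},
      {(3, 3), (5, 1)},
      {(3, 3), (6, 2)},
      {(4, 1), (4, 4)},
      {(4, 1), (5, 3)},
      {(4, 1), (6, 2)},
      {(4, 4), (5, 1)},
      {(4, 4), (6, 1)},
      {(5, 1), (5, 3)},
      {(5, 1), (6, 2)},
      {(5, 3), (6, 1)},
      {(6, 1), (6, 2)}} :: cell set set"
  have L: "e \<in> ?L"
    if eK: "e \<in> K" and ne: "e \<noteq> {(1, 3), (2, 4)}" for e
  proof -
    have "e \<inter> {(1, 3), (2, 4)} = {}"
      using disj e0 eK ne by blast
    moreover obtain a b c d where "(a, b, c, d) \<in> column_perms"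
        "e = row_edge std_row a b c d \<or> e = cross_edge std_row a b c d"
      using form[OF eK] unfolding all_columns_iff by blast
    ultimately show ?thesis
      using eK ex unfolding column_perms_def
      by (elim insertE emptyE disjE; simp add: r row_edge_def cross_edge_def insert_commute)
  qed
  have contra: "(P \<Longrightarrow> \<not> Q) \<Longrightarrow> P \<longrightarrow> \<not> Q" "(P \<Longrightarrow> \<not> Q) \<Longrightarrow> Q \<longrightarrow> \<not> P" for P Q
    by blast+
  note compat = compat[THEN contra(1)] compat[THEN contra(2)]
  let ?e0 = "{(1, 3), (2, 4)} :: cell set"
  let ?S = "{{(2, 2), (6, 1)}, {(3, 2), (5, 3)}, {(4, 4), (5, 1)}} :: cell set set"
  \<comment> \<open>Infinite sets have \<open>card\<close> 0.\<close>
  have fin: "finite K"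
    using card card.infinite by fastforce
  \<comment> \<open>If the neighbours \<open>N\<close> of \<open>e\<close> in the compatibility graph are pairwise incompatible, then
    \<open>e\<close> lies in no triangle, whereas \<open>K\<close> contains three two-edges besides \<open>A3 + B4\<close>.\<close>
  have excluded: "e \<notin> K"
    if N: "e \<in> K \<Longrightarrow> \<forall>w\<in>?L. w \<in> K \<longrightarrow> w \<inter> e = {} \<longrightarrow> w \<in> N"
      and N': "\<forall>v\<in>N. \<forall>w\<in>N. v \<in> K \<longrightarrow> w \<in> K \<longrightarrow> v \<inter> w = {} \<longrightarrow> v = w" for e N
  proof
    assume e: "e \<in> K"
    have "w \<in> N" if "w \<in> K - {?e0, e}" for w
    proof -
      have w: "w \<in> K" "w \<noteq> ?e0" "w \<noteq> e"
        using that by simp_all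
      show ?thesis
        by (rule N[OF e, rule_format, OF L[OF w(1,2)] w(1) disj[OF w(1) e w(3)]])
    qed
    then have eq: "v = w" if "v \<in> K - {?e0, e}" "w \<in> K - {?e0, e}" for v w
      using N' that disj[of v w] by (metis DiffD1)
    define A where "A = K - {?e0, e}"
    have "finite A" "\<And>v w. v \<in> A \<Longrightarrow> w \<in> A \<Longrightarrow> v = w"
      unfolding A_def using fin eq by (simp, iprover)
    then have "card A \<le> 1"
      by (metis One_nat_def card_le_Suc0_iff_eq)
    moreover have "card K \<le> card A + card {?e0, e}"
      using fin card_Un_le[of A "{?e0, e}"] card_mono[of "A \<union> {?e0, e}" K] unfolding A_def by force
    moreover have "card {?e0, e} \<le> 2"
      by (simp add: card_insert_if)
    ultimately show False
      using card by linarith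
  qed
  \<comment> \<open>Each set passed to \<open>excluded\<close> lists the neighbours of one of the
    eleven candidates outside the triangle.\<close>
  have x0: "{(3, 2), (6, 1)} \<notin> K"
    by (rule excluded[of _ "{{(4, 1), (4, 4)}, {(4, 1), (5, 3)}, {(4, 1), (6, 2)}, {(4, 4), (5, 1)}}"];
        auto simp: compat doubleton_eq_iff)
  have x1: "{(3, 3), (5, 1)} \<notin> K"
    by (rule excluded[of _ "{{(2, 2), (6, 1)}, {(4, 1), (4, 4)}, {(4, 1), (6, 2)}, {(4, 4), (6, 1)},
          {(6, 1), (6, 2)}}"];
        auto simp: compat doubleton_eq_iff)
  have x2: "{(3, 3), (6, 2)} \<notin> K"
    by (rule excluded[of _ "{{(4, 1), (4, 4)}, {(4, 1), (5, 3)}, {(4, 4), (5, 1)}, {(4, 4), (6, 1)}}"];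
        auto simp: compat doubleton_eq_iff)
  have x3: "{(4, 1), (4, 4)} \<notin> K"
    by (rule excluded[of _ "{{(3, 2), (5, 3)}, {(3, 2), (6, 1)}, {(3, 3), (5, 1)}, {(3, 3), (6, 2)},
          {(5, 1), (5, 3)}, {(5, 1), (6, 2)}, {(5, 3), (6, 1)}}"];
        auto simp: compat doubleton_eq_iff)
  have x4: "{(4, 1), (5, 3)} \<notin> K"
    by (rule excluded[of _ "{{(2, 2), (6, 1)}, {(3, 2), (6, 1)}, {(3, 3), (6, 2)}, {(6, 1), (6, 2)}}"];
        auto simp: compat doubleton_eq_iff)
  have x5: "{(4, 1), (6, 2)} \<notin> K"
    by (rule excluded[of _ "{{(3, 2), (5, 3)}, {(3, 2), (6, 1)}, {(3, 3), (5, 1)}, {(5, 1), (5, 3)},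
          {(5, 3), (6, 1)}}"];
        auto simp: compat doubleton_eq_iff)
  have x6: "{(4, 4), (6, 1)} \<notin> K"
    by (rule excluded[of _ "{{(3, 2), (5, 3)}, {(3, 3), (5, 1)}, {(3, 3), (6, 2)}, {(5, 1), (5, 3)},
          {(5, 1), (6, 2)}}"];
        auto simp: compat doubleton_eq_iff)
  have x7: "{(5, 1), (5, 3)} \<notin> K"
    by (rule excluded[of _ "{{(2, 2), (6, 1)}, {(4, 1), (4, 4)}, {(4, 1), (6, 2)}, {(4, 4), (6, 1)},
          {(6, 1), (6, 2)}}"];
        auto simp: compat doubleton_eq_iff)
  have x8: "{(5, 1), (6, 2)} \<notin> K"
    by (rule excluded[of _ "{{(2, 2), (6, 1)}, {(4, 1), (4, 4)}, {(4, 4), (6, 1)}}"];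
        auto simp: compat doubleton_eq_iff)
  have x9: "{(5, 3), (6, 1)} \<notin> K"
    by (rule excluded[of _ "{{(4, 1), (4, 4)}, {(4, 1), (6, 2)}, {(4, 4), (5, 1)}}"];
        auto simp: compat doubleton_eq_iff)
  have x10: "{(6, 1), (6, 2)} \<notin> K"
    by (rule excluded[of _ "{{(3, 3), (5, 1)}, {(4, 1), (5, 3)}, {(4, 4), (5, 1)}, {(5, 1), (5, 3)}}"];
        auto simp: compat doubleton_eq_iff)
  have "K - {?e0} \<subseteq> ?S"
  proof
    fix e
    assume "e \<in> K - {?e0}"
    then have "e \<in> K" "e \<noteq> ?e0"
      by simp_all
    from L[OF this] \<open>e \<in> K\<close> show "e \<in> ?S"
      by (elim insertE emptyE; simp add: x0 x1 x2 x3 x4 x5 x6 x7 x8 x9 x10)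
  qed
  moreover have "card ?S \<le> card (K - {?e0})"
    using card e0 by (simp add: doubleton_eq_iff)
  ultimately have "K - {?e0} = ?S"
    by (intro card_seteq) simp_all
  then show ?thesis
    using insert_Diff[OF e0] by (simp only:)
qed

section \<open>Irreducible configurations on the incidences of \<open>K\<^sub>4\<close>\<close>

lemma all_columns_swap:
  assumes "all_columns a b c d"
  shows "all_columns b a c d"
  using assms by (auto simp: all_columns_def insert_commute)

text \<open>The rows are labelled by the edges of \<open>K_4\<close>, given as a symmetric function
  of two vertices; \<open>limited_64_labelling\<close> supplies such an \<open>r\<close>.\<close>

locale k4_labelling =
  fixes G :: config and r :: "nat \<Rightarrow> nat \<Rightarrow> nat"
  assumes irr: "irreducible_config 6 4 G" and simple: "simple_config G"
    and row_range: "\<And>a b. a \<in> {1..4} \<Longrightarrow> b \<in> {1..4} \<Longrightarrow> a \<noteq> b \<Longrightarrow> r a b \<in> {1..6}"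
    and one_iff: "\<And>a b j. a \<in> {1..4} \<Longrightarrow> b \<in> {1..4} \<Longrightarrow> a \<noteq> b \<Longrightarrow>
      (r a b, j) \<in> one_edges G \<longleftrightarrow> j = a \<or> j = b"
    and row_commute: "\<And>a b. r a b = r b a"
    and row_exhaust: "\<And>i. i \<in> {1..6} \<Longrightarrow> \<exists>a\<in>{1..4}. \<exists>b\<in>{1..4}. a \<noteq> b \<and> i = r a b"
begin

lemma row_eq_iff:
  assumes "{a, b, c, d} \<subseteq> {1..4}" "a \<noteq> b" "c \<noteq> d"
  shows "r a b = r c d \<longleftrightarrow> {a, b} = {c, d}"
proof
  assume eq: "r a b = r c d"
  have "j = a \<or> j = b \<longleftrightarrow> j = c \<or> j = d" for j
    using one_iff[of a b j] one_iff[of c d j] assms unfolding eq by simp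
  then show "{a, b} = {c, d}"
    by blast
next
  assume "{a, b} = {c, d}"
  then show "r a b = r c d"
    using row_commute by (auto simp: doubleton_eq_iff)
qed

lemma all_columns_facts:
  assumes "all_columns a b c d"
  shows columns_mem: "a \<in> {1..4}" "b \<in> {1..4}" "c \<in> {1..4}" "d \<in> {1..4}"
    and columns_distinct: "distinct [a, b, c, d]"
    and rows_distinct: "distinct [r a b, r a c, r a d, r b c, r b d, r c d]"
    and one_mem: "(r a b, a) \<in> one_edges G" "(r a b, b) \<in> one_edges G"
      "(r a c, a) \<in> one_edges G" "(r a c, c) \<in> one_edges G"
      "(r a d, a) \<in> one_edges G" "(r a d, d) \<in> one_edges G"
      "(r b c, b) \<in> one_edges G" "(r b c, c) \<in> one_edges G"
      "(r b d, b) \<in> one_edges G" "(r b d, d) \<in> one_edges G"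
      "(r c d, c) \<in> one_edges G" "(r c d, d) \<in> one_edges G"
proof -
  have eq: "{a, b, c, d} = {1..4}" and ne: "a \<noteq> b" "a \<noteq> c" "a \<noteq> d" "b \<noteq> c" "b \<noteq> d" "c \<noteq> d"
    using assms by (auto simp: all_columns_def)
  show mem: "a \<in> {1..4}" "b \<in> {1..4}" "c \<in> {1..4}" "d \<in> {1..4}"
    unfolding eq[symmetric] by simp_all
  show "distinct [a, b, c, d]"
    using ne by simp
  show "distinct [r a b, r a c, r a d, r b c, r b d, r c d]"
    using ne mem by (simp add: row_eq_iff doubleton_eq_iff)
  show "(r a b, a) \<in> one_edges G" "(r a b, b) \<in> one_edges G"
      "(r a c, a) \<in> one_edges G" "(r a c, c) \<in> one_edges G"
      "(r a d, a) \<in> one_edges G" "(r a d, d) \<in> one_edges G"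
      "(r b c, b) \<in> one_edges G" "(r b c, c) \<in> one_edges G"
      "(r b d, b) \<in> one_edges G" "(r b d, d) \<in> one_edges G"
      "(r c d, c) \<in> one_edges G" "(r c d, d) \<in> one_edges G"
    using ne mem by (simp_all add: one_iff)
qed

section \<open>Reducible patterns in a labelled configuration\<close>

lemma not_A3B2:
  assumes "all_columns a b c d"
  shows "{(r a b, c), (r a c, b)} \<notin> two_edges G"
proof
  assume "{(r a b, c), (r a c, b)} \<in> two_edges G"
  then show False
    using all_columns_facts[OF assms]
    by (intro reducible_A3B2[OF irr, where p = "r a b" and q = "r a c" and a = a and b = b and c = c]) simp_all
qed

lemma not_A3C3:
  assumes "all_columns a b c d"
  shows "{(r a b, c), (r a d, c)} \<notin> two_edges G"
proof
  assume "{(r a b, c), (r a d, c)} \<in> two_edges G"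
  then show False
    using all_columns_facts[OF assms]
    by (intro reducible_A3C3[OF irr, where p = "r a b" and q = "r a c" and r = "r a d" and a = a and b = c]) simp_all
qed

lemma not_A3F1:
  assumes "all_columns a b c d"
  shows "{(r a b, c), (r c d, a)} \<notin> two_edges G"
proof
  assume "{(r a b, c), (r c d, a)} \<in> two_edges G"
  then show False
    using all_columns_facts[OF assms]
    by (intro reducible_A3F1[OF irr, where p = "r a b" and q = "r a c" and r = "r c d" and a = a and b = c]) simp_all
qed

lemma not_A3A4_B2B4:
  assumes "all_columns a b c d" "row_edge r a b c d \<in> two_edges G"
  shows "row_edge r a c b d \<notin> two_edges G"
proof
  assume "row_edge r a c b d \<in> two_edges G"
  then show False
    using all_columns_facts[OF assms(1)] assms(2)
    by (intro reducible_A3A4_B2B4[OF irr, where p = "r a b" and q = "r a c" and a = a and b = b and c = c and d = d])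
      (simp_all add: row_edge_def)
qed

lemma not_A3A4_B2C3:
  assumes "all_columns a b c d" "row_edge r a b c d \<in> two_edges G"
  shows "{(r a c, b), (r a d, c)} \<notin> two_edges G"
proof
  assume "{(r a c, b), (r a d, c)} \<in> two_edges G"
  then show False
    using all_columns_facts[OF assms(1)] assms(2)
    by (intro reducible_A3A4_B2C3[OF irr, where p = "r a b" and q = "r a c" and r = "r a d"
          and a = a and b = b and c = c and d = d]) (simp_all add: row_edge_def)
qed

lemma not_A3B4_A4B2:
  assumes "all_columns a b c d" "cross_edge r a b c d \<in> two_edges G"
  shows "{(r a b, d), (r a c, b)} \<notin> two_edges G"
proof
  assume "{(r a b, d), (r a c, b)} \<in> two_edges G"
  then show False
    using all_columns_facts[OF assms(1)] assms(2)
    by (intro reducible_A3B4_A4B2[OF irr, where p = "r a b" and q = "r a c" and a = a and b = b and c = c and d = d])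
      (simp_all add: cross_edge_def)
qed

lemma not_A3B4_A4C3:
  assumes "all_columns a b c d" "cross_edge r a b c d \<in> two_edges G"
  shows "{(r a b, d), (r a d, c)} \<notin> two_edges G"
proof
  assume "{(r a b, d), (r a d, c)} \<in> two_edges G"
  then show False
    using all_columns_facts[OF assms(1)] assms(2)
    by (intro reducible_A3B4_A4C3[OF irr, where p = "r a b" and q = "r a c" and r = "r a d" and a = a and b = c and c = d])
      (simp_all add: cross_edge_def)
qed

lemma not_A3B4_A4D1:
  assumes "all_columns a b c d" "cross_edge r a b c d \<in> two_edges G"
  shows "{(r a b, d), (r b c, a)} \<notin> two_edges G"
proof
  assume "{(r a b, d), (r b c, a)} \<in> two_edges G"
  then show False
    using all_columns_facts[OF assms(1)] assms(2)
    by (intro reducible_A3B4_A4D1[OF irr, where p = "r a b" and q = "r a c" and r = "r b c" and a = a and b = c and c = d])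
      (simp_all add: cross_edge_def)
qed

lemma not_A3B4_A4E3:
  assumes "all_columns a b c d" "cross_edge r a b c d \<in> two_edges G"
  shows "{(r a b, d), (r b d, c)} \<notin> two_edges G"
proof
  assume "{(r a b, d), (r b d, c)} \<in> two_edges G"
  then show False
    using all_columns_facts[OF assms(1)] assms(2)
    by (intro reducible_A3B4_A4E3[OF irr, where p = "r a b" and q = "r a c" and r = "r b d" and s = "r c d"
          and a = c and b = d])
      (simp_all add: cross_edge_def)
qed

lemma not_A3B4_B2C3:
  assumes "all_columns a b c d" "cross_edge r a b c d \<in> two_edges G"
  shows "{(r a c, b), (r a d, c)} \<notin> two_edges G"
proof
  assume "{(r a c, b), (r a d, c)} \<in> two_edges G"
  then show False
    using all_columns_facts[OF assms(1)] assms(2)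
    by (intro reducible_A3B4_B2C3[OF irr, where p = "r a b" and q = "r a c" and r = "r a d"
          and a = a and b = b and c = c and d = d]) (simp_all add: cross_edge_def)
qed

text \<open>Each of the six edges of \<open>K_4\<close> misses two vertices, which gives twelve free
  cells.\<close>

lemma free_cell_cases:
  assumes cols: "all_columns a b c d" and "q \<in> cells 6 4" "q \<notin> one_edges G"
  shows "q \<in> {(r a b, c), (r a b, d), (r a c, b), (r a c, d), (r a d, b), (r a d, c),
    (r b c, a), (r b c, d), (r b d, a), (r b d, c), (r c d, a), (r c d, b)}"
proof -
  obtain i j where q: "q = (i, j)" and i: "i \<in> {1..6}" and j: "j \<in> {1..4}"
    using assms(2) by (auto simp: cells_def)
  obtain p s where ps: "p \<in> {1..4}" "s \<in> {1..4}" "p \<noteq> s" and r: "i = r p s"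
    using row_exhaust[OF i] by blast
  have j': "j \<noteq> p" "j \<noteq> s"
    using one_iff[OF ps, of j] assms(3) unfolding q r by auto
  have "p = a \<or> p = b \<or> p = c \<or> p = d" "s = a \<or> s = b \<or> s = c \<or> s = d" "j = a \<or> j = b \<or> j = c \<or> j = d"
    using cols ps(1,2) j unfolding all_columns_def by blast+
  then show ?thesis
    using ps(3) j' row_commute[of b a] row_commute[of c a] row_commute[of d a]
      row_commute[of c b] row_commute[of d b] row_commute[of d c]
    unfolding q r by (elim disjE) simp_all
qed

lemma all_columns_exists:
  assumes "a \<in> {1..4}" "b \<in> {1..4}" "c \<in> {1..4}" "distinct [a, b, c]"
  obtains d where "all_columns a b c d"
proof -
  have "card ({1..4} - {a, b, c}) = 1"
    using assms by (simp add: card_Diff_subset)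
  then obtain d where d: "{1..4} - {a, b, c} = {d}"
    by (auto simp: card_Suc_eq One_nat_def)
  then have "insert d {a, b, c} = {1..4}" "d \<notin> {a, b, c}"
    using assms(1-3) by blast+
  then have "all_columns a b c d"
    using assms(4) by (auto simp: all_columns_def insert_commute)
  then show thesis by (rule that)
qed

text \<open>Let one cell be \<open>(r a b, j)\<close>. Of the eleven other free cells, six are
  excluded by patterns with a single two-edge; the other five give one row edge and four cross
  edges.\<close>

lemma two_edge_form:
  assumes e: "e \<in> two_edges G"
  shows "\<exists>a b c d. all_columns a b c d \<and> (e = row_edge r a b c d \<or> e = cross_edge r a b c d)"
proof -
  have conf: "configuration 6 4 G"
    using irr by (simp add: irreducible_config_def)
  then have "e \<subseteq> cells 6 4" "card e = 2"
    using e by (auto simp: configuration_def)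
  have free: "p \<notin> one_edges G" if "p \<in> e" for p
  proof
    assume "p \<in> one_edges G"
    then have "{p} \<in> supports G" "e \<in> supports G"
      using e by (auto simp: supports_def)
    moreover have "{p} \<noteq> e"
      using \<open>card e = 2\<close> by auto
    ultimately have "{p} \<inter> e = {}"
      using simple disjointD unfolding simple_config_def by metis
    then show False
      using that by simp
  qed
  obtain p q where pq: "e = {p, q}" "p \<noteq> q"
    using \<open>card e = 2\<close> by (auto simp: card_2_iff)
  obtain i j where p: "p = (i, j)" and i: "i \<in> {1..6}" and j: "j \<in> {1..4}"
    using \<open>e \<subseteq> cells 6 4\<close> pq by (auto simp: cells_def)
  obtain a b where ab: "a \<in> {1..4}" "b \<in> {1..4}" "a \<noteq> b" and r: "i = r a b"
    using row_exhaust[OF i] by blast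
  have "j \<noteq> a" "j \<noteq> b"
    using one_iff[OF ab, of j] free[of p] pq unfolding p r by auto
  then obtain d where cols: "all_columns a b j d"
    using all_columns_exists[of a b j] ab j by auto
  have "q \<in> cells 6 4" "q \<notin> one_edges G"
    using pq free \<open>e \<subseteq> cells 6 4\<close> by auto
  note q = free_cell_cases[OF cols this]
  note excluded = not_A3B2[OF cols] not_A3B2[OF all_columns_swap[OF cols]]
    not_A3C3[OF cols] not_A3C3[OF all_columns_swap[OF cols]]
    not_A3F1[OF cols] not_A3F1[OF all_columns_swap[OF cols]]
  have ne: "q \<noteq> (r a b, j)"
    using pq(2) p r by simp
  consider "e = row_edge r a b j d" | "e = cross_edge r a b j d" | "e = cross_edge r a d b j"
    | "e = cross_edge r b a j d" | "e = cross_edge r b d a j"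
    using q
  proof (elim insertE emptyE)
  qed (use e excluded ne in \<open>simp_all add: pq(1) p r row_edge_def cross_edge_def insert_commute row_commute[of b a]\<close>)
  moreover have "all_columns a d b j" "all_columns b a j d" "all_columns b d a j"
    using cols by (auto simp: all_columns_def insert_commute)
  ultimately show ?thesis
    using cols by cases blast+
qed

end

lemma all_columns_mem:
  assumes "all_columns a b c d"
  shows "a \<in> {1..4}" "b \<in> {1..4}" "c \<in> {1..4}" "d \<in> {1..4}"
    "a \<noteq> b" "a \<noteq> c" "a \<noteq> d" "b \<noteq> c" "b \<noteq> d" "c \<noteq> d"
  using assms insertI1 by (auto simp: all_columns_def)

context k4_labelling
begin

text \<open>Row edges in the rows of adjacent edges of \<open>K_4\<close> exclude each other, so
  without cross edges at most two two-edges remain, in the rows of opposite edges.\<close>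

lemma cross_edge_exists:
  assumes card: "3 \<le> card (two_edges G)"
  shows "\<exists>a b c d. all_columns a b c d \<and> cross_edge r a b c d \<in> two_edges G"
proof (rule ccontr)
  assume no_cross: "\<not> ?thesis"
  have form: "\<exists>a b c d. all_columns a b c d \<and> e = row_edge r a b c d" if "e \<in> two_edges G" for e
    using two_edge_form[OF that] no_cross that by blast
  obtain e where e: "e \<in> two_edges G"
    using card by fastforce
  obtain a b c d where cols: "all_columns a b c d" and e_eq: "e = row_edge r a b c d"
    using form[OF e] by blast
  have cols': "all_columns a b d c" "all_columns b a c d" "all_columns b a d c"
    using cols by (auto simp: all_columns_def insert_commute)
  have "row_edge r a b d c \<in> two_edges G" "row_edge r b a c d \<in> two_edges G" "row_edge r b a d c \<in> two_edges G"
    using e by (simp_all add: e_eq row_edge_def insert_commute row_commute)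
  \<comment> \<open>The four instances cover the four edges of \<open>K_4\<close> adjacent to
    \<open>a b\<close>.\<close>
  note excluded = not_A3A4_B2B4[OF cols e[unfolded e_eq]] not_A3A4_B2B4[OF cols'(1) this(1)]
    not_A3A4_B2B4[OF cols'(2) this(2)] not_A3A4_B2B4[OF cols'(3) this(3)]
  have swap: "row_edge r q p s t = row_edge r p q s t" "row_edge r p q t s = row_edge r p q s t" for p q s t
    by (simp_all add: row_edge_def insert_commute row_commute)
  have "f = row_edge r a b c d \<or> f = row_edge r c d a b" if f: "f \<in> two_edges G" for f
  proof -
    obtain p q s t where cols'': "all_columns p q s t" and f_eq: "f = row_edge r p q s t"
      using form[OF f] by blast
    have abcd: "a \<noteq> b" "a \<noteq> c" "a \<noteq> d" "b \<noteq> c" "b \<noteq> d" "c \<noteq> d" "{a, b, c, d} = {1..4}"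
      and pqst: "p \<noteq> q" "p \<noteq> s" "p \<noteq> t" "q \<noteq> s" "q \<noteq> t" "s \<noteq> t" "{p, q, s, t} = {1..4}"
      using cols cols'' by (simp_all add: all_columns_def)
    have st: "{s, t} = {a, b, c, d} - {p, q}"
      unfolding abcd(7) pqst(7)[symmetric] using pqst(1-6) by auto
    have "p \<in> {a, b, c, d}" "q \<in> {a, b, c, d}"
      unfolding abcd(7) pqst(7)[symmetric] by simp_all
    then have "p = a \<or> p = b \<or> p = c \<or> p = d" "q = a \<or> q = b \<or> q = c \<or> q = d"
      by simp_all
    then have pq: "{p, q} = {a, b} \<or> {p, q} = {a, c} \<or> {p, q} = {a, d} \<or> {p, q} = {b, c} \<or> {p, q} = {b, d} \<or> {p, q} = {c, d}"
      using pqst(1) by (elim disjE) (simp_all add: doubleton_eq_iff)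
    have row: "f = row_edge r p' q' s' t'" if "{p, q} = {p', q'}" "{s, t} = {s', t'}" for p' q' s' t'
      using that by (auto simp: f_eq doubleton_eq_iff swap)
    have minus: "{a, b, c, d} - {a, b} = {c, d}" "{a, b, c, d} - {a, c} = {b, d}" "{a, b, c, d} - {a, d} = {b, c}"
      "{a, b, c, d} - {b, c} = {a, d}" "{a, b, c, d} - {b, d} = {a, c}" "{a, b, c, d} - {c, d} = {a, b}"
      using abcd(1-6) by auto
    show ?thesis
      using pq
    proof (elim disjE)
      assume *: "{p, q} = {a, b}"
      show ?thesis using row[OF * st[unfolded * minus]] by blast
    next
      assume *: "{p, q} = {a, c}"
      show ?thesis using row[OF * st[unfolded * minus]] f excluded by blast
    next
      assume *: "{p, q} = {a, d}"
      show ?thesis using row[OF * st[unfolded * minus]] f excluded by blast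
    next
      assume *: "{p, q} = {b, c}"
      show ?thesis using row[OF * st[unfolded * minus]] f excluded by blast
    next
      assume *: "{p, q} = {b, d}"
      show ?thesis using row[OF * st[unfolded * minus]] f excluded by blast
    next
      assume *: "{p, q} = {c, d}"
      show ?thesis using row[OF * st[unfolded * minus]] by blast
    qed
  qed
  then have "two_edges G \<subseteq> {row_edge r a b c d, row_edge r c d a b}"
    by blast
  then have "card (two_edges G) \<le> card {row_edge r a b c d, row_edge r c d a b}"
    by (intro card_mono) simp_all
  also have "\<dots> \<le> 2"
    by (simp add: card_insert_if)
  finally show False
    using card by simp
qed

text \<open>Relabelling turns a cross edge into \<open>A3 + B4\<close>; then
  \<open>two_edges_unique\<close> determines the two-edges, and counting the one-edges.\<close>

lemma isomorphic_G64:
  assumes card1: "card (one_edges G) = 12" and card2: "4 \<le> card (two_edges G)"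
  shows "isomorphic 6 4 G64 G"
proof -
  obtain a b c d where cols: "all_columns a b c d" and cross: "cross_edge r a b c d \<in> two_edges G"
    using cross_edge_exists card2 by fastforce
  note facts = all_columns_facts[OF cols]
  \<comment> \<open>Rows follow the columns according to \<open>std_row\<close>; both maps are the
    identity outside the grid, as \<open>permutes\<close> demands.\<close>
  define \<sigma> where "\<sigma> j = (if j = 1 then a else if j = 2 then b else if j = 3 then c else if j = 4 then d else j)" for j
  define \<pi> where "\<pi> i = (if i = 1 then r a b else if i = 2 then r a c else if i = 3 then r a d
    else if i = 4 then r b c else if i = 5 then r b d else if i = 6 then r c d else i)" for i
  define \<phi> where "\<phi> = map_prod \<pi> \<sigma>"
  have nums: "{1..4::nat} = {1, 2, 3, 4}" "{1..6::nat} = {1, 2, 3, 4, 5, 6}"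
    by auto
  have "\<sigma> ` {1..4} = {a, b, c, d}"
    unfolding nums(1) by (simp add: \<sigma>_def insert_commute)
  then have \<sigma>_image: "\<sigma> ` {1..4} = {1..4}"
    using cols by (simp add: all_columns_def)
  then have "inj_on \<sigma> {1..4}"
    by (intro eq_card_imp_inj_on) simp_all
  then have \<sigma>: "\<sigma> permutes {1..4}"
    using \<sigma>_image by (intro bij_imp_permutes) (auto simp: bij_betw_def \<sigma>_def)
  have \<pi>_image: "\<pi> ` {1..6} = {r a b, r a c, r a d, r b c, r b d, r c d}"
    unfolding nums(2) by (simp add: \<pi>_def insert_commute)
  have "{r a b, r a c, r a d, r b c, r b d, r c d} \<subseteq> {1..6}"
    unfolding insert_subset by (intro conjI row_range empty_subsetI; rule all_columns_mem[OF cols])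
  then have "\<pi> ` {1..6} \<subseteq> {1..6}"
    by (simp only: \<pi>_image)
  moreover have \<pi>_inj: "inj_on \<pi> {1..6}"
  proof (rule eq_card_imp_inj_on)
    show "card (\<pi> ` {1..6}) = card {1..6::nat}"
      unfolding \<pi>_image using facts(6) by simp
  qed simp
  ultimately have \<pi>: "\<pi> permutes {1..6}"
  proof (intro bij_imp_permutes)
    show "\<pi> i = i" if "i \<notin> {1..6}" for i
      using that by (auto simp: \<pi>_def)
  qed (simp add: bij_betw_def endo_inj_surj)
  note [simp del] = One_nat_def atLeastAtMost_iff
  have inj: "inj \<phi>" and surj: "surj \<phi>"
    using permutes_inj[OF \<pi>] permutes_inj[OF \<sigma>] permutes_surj[OF \<pi>] permutes_surj[OF \<sigma>]
    by (simp_all add: \<phi>_def prod.inj_map map_prod_surj)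
  have rows: "\<pi> (std_row p q) = r (\<sigma> p) (\<sigma> q)" if "p \<in> {1, 2, 3, 4}" "q \<in> {1, 2, 3, 4}" "p \<noteq> q" for p q
    using that by (elim insertE emptyE) (simp_all add: std_row_def \<pi>_def \<sigma>_def row_commute[of b a]
      row_commute[of c a] row_commute[of d a] row_commute[of c b] row_commute[of d b] row_commute[of d c])
  have cell: "\<phi> (std_row p q, s) = (r (\<sigma> p) (\<sigma> q), \<sigma> s)" if "p \<in> {1..4}" "q \<in> {1..4}" "p \<noteq> q" for p q s
    using rows that unfolding nums(1) by (simp add: \<phi>_def)
  have cols_\<sigma>: "all_columns (\<sigma> p) (\<sigma> q) (\<sigma> s) (\<sigma> t)" if "all_columns p q s t" for p q s t
  proof -
    have "\<sigma> ` {p, q, s, t} = {1..4}"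
      using that \<sigma>_image by (simp add: all_columns_def)
    then show ?thesis
      using that permutes_inj[OF \<sigma>] by (simp add: all_columns_def inj_eq)
  qed
  \<comment> \<open>The two-edges of \<open>G\<close> are pulled back to the standard
    labelling.\<close>
  define K where "K = {e. \<phi> ` e \<in> two_edges G}"
  have K_image: "(\<lambda>e. \<phi> ` e) ` K = two_edges G"
  proof
    show "two_edges G \<subseteq> (\<lambda>e. \<phi> ` e) ` K"
    proof
      fix e
      assume "e \<in> two_edges G"
      moreover have "e = \<phi> ` (\<phi> -` e)"
        using surj by (simp add: surj_image_vimage_eq)
      ultimately show "e \<in> (\<lambda>e. \<phi> ` e) ` K"
        unfolding K_def by (intro image_eqI[of _ _ "\<phi> -` e"]) simp_all
    qed
  qed (auto simp: K_def)
  have "inj_on (\<lambda>e. \<phi> ` e) K"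
    using inj by (simp add: inj_on_def inj_image_eq_iff)
  then have "card K = card (two_edges G)"
    using card_image K_image by fastforce
  have edges: "\<phi> ` row_edge std_row p q s t = row_edge r (\<sigma> p) (\<sigma> q) (\<sigma> s) (\<sigma> t)"
    "\<phi> ` cross_edge std_row p q s t = cross_edge r (\<sigma> p) (\<sigma> q) (\<sigma> s) (\<sigma> t)"
    if "all_columns p q s t" for p q s t
    using all_columns_mem[OF that] by (simp_all add: row_edge_def cross_edge_def cell)
  have pair: "{(std_row p q, s), (std_row p' q', s')} \<in> K \<longleftrightarrow>
      {(r (\<sigma> p) (\<sigma> q), \<sigma> s), (r (\<sigma> p') (\<sigma> q'), \<sigma> s')} \<in> two_edges G"
    if "p \<in> {1..4}" "q \<in> {1..4}" "p \<noteq> q" "p' \<in> {1..4}" "q' \<in> {1..4}" "p' \<noteq> q'" for p q s p' q' s'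
    using that by (simp add: K_def cell)
  note defs = row_edge_def cross_edge_def
  have "K = {{(1, 3), (2, 4)}, {(2, 2), (6, 1)}, {(3, 2), (5, 3)}, {(4, 4), (5, 1)}}"
  proof (rule two_edges_unique)
    show "4 \<le> card K"
      using card2 \<open>card K = _\<close> by simp
    show "{(1, 3), (2, 4)} \<in> K"
      using cross by (simp add: K_def \<phi>_def \<pi>_def \<sigma>_def cross_edge_def)
    show "e \<inter> f = {}" if "e \<in> K" "f \<in> K" "e \<noteq> f" for e f
    proof -
      have "\<phi> ` e \<in> supports G" "\<phi> ` f \<in> supports G" "\<phi> ` e \<noteq> \<phi> ` f"
        using that inj by (simp_all add: K_def supports_def inj_image_eq_iff)
      then have "\<phi> ` e \<inter> \<phi> ` f = {}"
        using simple disjointD unfolding simple_config_def by blast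
      then show ?thesis
        by blast
    qed
    show "\<exists>p q s t. all_columns p q s t \<and> (e = row_edge std_row p q s t \<or> e = cross_edge std_row p q s t)"
      if eK: "e \<in> K" for e
    proof -
      obtain a' b' c' d' where cols': "all_columns a' b' c' d'"
        and e: "\<phi> ` e = row_edge r a' b' c' d' \<or> \<phi> ` e = cross_edge r a' b' c' d'"
        using two_edge_form[of "\<phi> ` e"] eK unfolding K_def by blast
      let ?\<tau> = "inv \<sigma>"
      have \<tau>: "?\<tau> permutes {1..4}"
        using \<sigma> by (rule permutes_inv)
      have "?\<tau> ` {a', b', c', d'} = {1..4}"
        using cols' permutes_image[OF \<tau>] by (simp add: all_columns_def)
      then have "all_columns (?\<tau> a') (?\<tau> b') (?\<tau> c') (?\<tau> d')"
        using cols' permutes_inj[OF \<tau>] by (simp add: all_columns_def inj_eq)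
      moreover have "\<sigma> (?\<tau> j) = j" for j
        using permutes_inverses(1)[OF \<sigma>] .
      ultimately show ?thesis
        using e edges[of "?\<tau> a'" "?\<tau> b'" "?\<tau> c'" "?\<tau> d'"] inj_image_eq_iff[OF inj] by metis
    qed
  next
    fix p q s t
    assume *: "all_columns p q s t"
    show "row_edge std_row p s q t \<notin> K" if "row_edge std_row p q s t \<in> K"
      using not_A3A4_B2B4[OF cols_\<sigma>[OF *]] that all_columns_mem[OF *] by (simp add: defs pair)
    show "{(std_row p s, q), (std_row p t, s)} \<notin> K" if "row_edge std_row p q s t \<in> K"
      using not_A3A4_B2C3[OF cols_\<sigma>[OF *]] that all_columns_mem[OF *] by (simp add: defs pair)
    show "{(std_row p q, t), (std_row p s, q)} \<notin> K" if "cross_edge std_row p q s t \<in> K"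
      using not_A3B4_A4B2[OF cols_\<sigma>[OF *]] that all_columns_mem[OF *] by (simp add: defs pair)
    show "{(std_row p q, t), (std_row p t, s)} \<notin> K" if "cross_edge std_row p q s t \<in> K"
      using not_A3B4_A4C3[OF cols_\<sigma>[OF *]] that all_columns_mem[OF *] by (simp add: defs pair)
    show "{(std_row p q, t), (std_row q s, p)} \<notin> K" if "cross_edge std_row p q s t \<in> K"
      using not_A3B4_A4D1[OF cols_\<sigma>[OF *]] that all_columns_mem[OF *] by (simp add: defs pair)
    show "{(std_row p q, t), (std_row q t, s)} \<notin> K" if "cross_edge std_row p q s t \<in> K"
      using not_A3B4_A4E3[OF cols_\<sigma>[OF *]] that all_columns_mem[OF *] by (simp add: defs pair)
    show "{(std_row p s, q), (std_row p t, s)} \<notin> K" if "cross_edge std_row p q s t \<in> K"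
      using not_A3B4_B2C3[OF cols_\<sigma>[OF *]] that all_columns_mem[OF *] by (simp add: defs pair)
  qed
  then have two: "(\<lambda>e. \<phi> ` e) ` two_edges G64 = two_edges G"
    using K_image by (simp add: G64_def)
  have "\<phi> ` one_edges G64 \<subseteq> one_edges G"
    using facts by (simp add: G64_def \<phi>_def \<pi>_def \<sigma>_def)
  moreover have "card (\<phi> ` one_edges G64) = 12"
    by (subst card_image[OF inj_on_subset[OF inj subset_UNIV]]) (simp add: G64_def)
  ultimately have one: "\<phi> ` one_edges G64 = one_edges G"
    using card1 card.infinite by (intro card_subset_eq) fastforce+
  show ?thesis
    unfolding isomorphic_def using \<pi> \<sigma> one two unfolding \<phi>_def by blast
qed

end

section \<open>Limited configurations and the classification\<close>

definition row_set :: "cell set \<Rightarrow> nat \<Rightarrow> nat set" where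
  "row_set E i = {j. (i, j) \<in> E}"

lemma C4_free_row_sets:
  assumes "C4_free E" "i \<noteq> k" "s \<subseteq> row_set E i" "s \<subseteq> row_set E k"
  shows "card s \<noteq> 2"
proof
  assume "card s = 2"
  then obtain j l where "s = {j, l}" "j \<noteq> l"
    by (auto simp: card_2_iff)
  then have "{(i, j), (i, l), (k, j), (k, l)} \<subseteq> E"
    using assms(3,4) by (auto simp: row_set_def)
  with \<open>i \<noteq> k\<close> \<open>j \<noteq> l\<close> have "\<not> C4_free E"
    unfolding C4_free_def not_not by (intro exI conjI)
  with assms(1) show False
    by contradiction
qed

lemma row_set_subset:
  assumes "E \<subseteq> cells m n"
  shows "row_set E i \<subseteq> {1..n}"
  using assms by (auto simp: row_set_def cells_def)

text \<open>A pair of columns lies in at most one row set, so the 2-subsets of different rows form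
  disjoint families.\<close>

lemma sum_choose_row_sets_le:
  assumes E: "E \<subseteq> cells m n" and free: "C4_free E"
  shows "(\<Sum>i\<in>{1..m}. card (row_set E i) choose 2) \<le> n choose 2"
proof -
  let ?S = "\<lambda>A. {s. s \<subseteq> A \<and> card s = 2}"
  note sub = row_set_subset[OF E]
  have fin: "finite (row_set E i)" for i
    using sub by (rule finite_subset) simp
  have "(\<Sum>i\<in>{1..m}. card (row_set E i) choose 2) = (\<Sum>i\<in>{1..m}. card (?S (row_set E i)))"
    by (simp add: n_subsets fin)
  also have "\<dots> = card (\<Union>i\<in>{1..m}. ?S (row_set E i))"
  proof (rule card_UN_disjoint[symmetric])
    show "\<forall>i\<in>{1..m}. finite (?S (row_set E i))"
      using fin by simp
    show "\<forall>i\<in>{1..m}. \<forall>k\<in>{1..m}. i \<noteq> k \<longrightarrow> ?S (row_set E i) \<inter> ?S (row_set E k) = {}"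
      using C4_free_row_sets[OF free] by blast
  qed simp
  also have "\<dots> \<le> card (?S {1..n})"
    using sub by (intro card_mono) auto
  also have "\<dots> = n choose 2"
    by (simp add: n_subsets)
  finally show ?thesis .
qed

lemma card_eq_sum_row_sets:
  assumes "E \<subseteq> cells m n"
  shows "card E = (\<Sum>i\<in>{1..m}. card (row_set E i))"
proof -
  have "E = Sigma {1..m} (row_set E)"
    using assms by (auto simp: row_set_def cells_def)
  moreover have "finite (row_set E i)" for i
    using row_set_subset[OF assms] by (rule finite_subset) simp
  ultimately show ?thesis
    using card_SigmaI[of "{1..m}" "row_set E"] by simp
qed

text \<open>Equality holds exactly for \<open>d \<in> {1, 2}\<close>, which forces two one-edges in each row.\<close>

lemma le_choose_two: "d \<le> (d choose 2) + 1"
  by (induction d) (auto simp: numeral_2_eq_2)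

text \<open>At most 6 pairs of columns are available, and a row has at most one cell more than
  pairs.\<close>

lemma C4_free_64_card_le:
  assumes "E \<subseteq> cells 6 4" "C4_free E"
  shows "card E \<le> 12"
proof -
  have "card E \<le> (\<Sum>i\<in>{1..6}. (card (row_set E i) choose 2) + 1)"
    unfolding card_eq_sum_row_sets[OF assms(1)] by (intro sum_mono le_choose_two)
  also have "\<dots> = (\<Sum>i\<in>{1..6}. card (row_set E i) choose 2) + 6"
    by (simp only: sum.distrib) simp
  also have "\<dots> \<le> 12"
    using sum_choose_row_sets_le[OF assms] by (simp add: choose_two)
  finally show ?thesis .
qed

text \<open>In the equality case a row with three or more cells would make
  \<open>le_choose_two\<close> strict; so all rows have at most two cells, and the total 12 forces
  exactly two.\<close>

lemma C4_free_64_row_card: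
  assumes E: "E \<subseteq> cells 6 4" and free: "C4_free E" and card: "card E = 12" and i: "i \<in> {1..6}"
  shows "card (row_set E i) = 2"
proof -
  let ?d = "\<lambda>i. card (row_set E i)"
  have sum: "(\<Sum>i\<in>{1..6}. ?d i) = 12"
    using card card_eq_sum_row_sets[OF E] by simp
  have choose: "(\<Sum>i\<in>{1..6}. ?d i choose 2) \<le> 6"
    using sum_choose_row_sets_le[OF E free] by (simp add: choose_two)
  have le: "?d i \<le> 2" if i: "i \<in> {1..6}" for i
  proof (rule ccontr)
    assume "\<not> ?d i \<le> 2"
    then obtain k where k: "?d i = Suc (Suc (Suc k))"
      by (metis Suc_eq_plus1 add_2_eq_Suc' less_eqE not_less_eq_eq numeral_2_eq_2 add_Suc)
    have "?d i < (?d i choose 2) + 1"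
      using le_choose_two[of k] by (simp add: k numeral_2_eq_2)
    then have "(\<Sum>i\<in>{1..6}. ?d i) < (\<Sum>i\<in>{1..6}. (?d i choose 2) + 1)"
      using i le_choose_two by (intro sum_strict_mono_ex1) auto
    moreover have "(\<Sum>i\<in>{1..6}. (?d i choose 2) + 1) = (\<Sum>i\<in>{1..6}. ?d i choose 2) + 6"
      by (simp only: sum.distrib) simp
    ultimately show False
      using sum choose by linarith
  qed
  show ?thesis
  proof (rule ccontr)
    assume "?d i \<noteq> 2"
    have "(\<Sum>i\<in>{1..6}. ?d i) < (\<Sum>i\<in>{1..6::nat}. 2)"
    proof (rule sum_strict_mono_ex1)
      show "\<exists>i\<in>{1..6}. ?d i < 2"
        using \<open>?d i \<noteq> 2\<close> i le[OF i] by (intro bexI[of _ i]) linarith+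
    qed (use le in simp_all)
    then show False
      using sum by simp
  qed
qed

lemma z_C4_64: "z_C4 6 4 = 12"
  unfolding z_C4_def
proof (rule Max_eqI)
  show "finite {card E |E. E \<subseteq> cells 6 4 \<and> C4_free E}"
    by (rule finite_subset[of _ "{..12}"]) (auto simp: C4_free_64_card_le)
  show "k \<le> 12" if "k \<in> {card E |E. E \<subseteq> cells 6 4 \<and> C4_free E}" for k
    using that by (auto simp: C4_free_64_card_le)
  show "12 \<in> {card E |E. E \<subseteq> cells 6 4 \<and> C4_free E}"
    using card_G64(1) configuration_G64 C4_free_G64 unfolding configuration_def
    by (intro CollectI exI[of _ "one_edges G64"]) simp
qed

lemma limited_G64: "limited 6 4 G64"
  by (simp add: limited_def configuration_G64 simple_G64 C4_free_G64 z_C4_64 card_G64)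

text \<open>The six rows yield different 2-subsets of the four columns, hence all six; inverting
  this bijection labels the rows.\<close>

lemma limited_64_labelling:
  assumes irr: "irreducible_config 6 4 G" and lim: "limited 6 4 G"
  obtains r where "k4_labelling G r"
proof -
  let ?E = "one_edges G" and ?P = "{s. s \<subseteq> {1..4::nat} \<and> card s = 2}"
  have E: "?E \<subseteq> cells 6 4" and free: "C4_free ?E" and card: "card ?E = 12" and simple: "simple_config G"
    using lim by (auto simp: limited_def configuration_def z_C4_64)
  note sub = row_set_subset[OF E]
  have inj: "inj_on (row_set ?E) {1..6}"
  proof (rule inj_onI, rule ccontr)
    fix i k
    assume i: "i \<in> {1..6}" and "row_set ?E i = row_set ?E k" "i \<noteq> k"
    then show False
      using C4_free_row_sets[OF free, of i k "row_set ?E i"] C4_free_64_row_card[OF E free card i] by simp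
  qed
  have "row_set ?E ` {1..6} \<subseteq> ?P"
    using sub C4_free_64_row_card[OF E free card] by auto
  moreover have "card ?P = 6"
    by (simp add: n_subsets choose_two)
  ultimately have image: "row_set ?E ` {1..6} = ?P"
    using inj by (intro card_subset_eq) (simp_all add: card_image)
  define r where "r a b = inv_into {1..6} (row_set ?E) {a, b}" for a b
  have pair: "{a, b} \<in> row_set ?E ` {1..6}" if "a \<in> {1..4}" "b \<in> {1..4}" "a \<noteq> b" for a b
    unfolding image using that by simp
  have r: "r a b \<in> {1..6}" "row_set ?E (r a b) = {a, b}" if "a \<in> {1..4}" "b \<in> {1..4}" "a \<noteq> b" for a b
    using inv_into_into[OF pair[OF that]] f_inv_into_f[OF pair[OF that]] by (simp_all add: r_def)
  have "k4_labelling G r"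
  proof
    show "irreducible_config 6 4 G" "simple_config G"
      by fact+
    show "r a b \<in> {1..6}" if "a \<in> {1..4}" "b \<in> {1..4}" "a \<noteq> b" for a b
      using r(1)[OF that] .
    show "(r a b, j) \<in> ?E \<longleftrightarrow> j = a \<or> j = b" if "a \<in> {1..4}" "b \<in> {1..4}" "a \<noteq> b" for a b j
      using r(2)[OF that] by (auto simp: row_set_def)
    show "r a b = r b a" for a b
      by (simp add: r_def insert_commute)
    show "\<exists>a\<in>{1..4}. \<exists>b\<in>{1..4}. a \<noteq> b \<and> i = r a b" if i: "i \<in> {1..6}" for i
    proof -
      obtain a b where ab: "row_set ?E i = {a, b}" "a \<noteq> b"
        using C4_free_64_row_card[OF E free card i] by (auto simp: card_2_iff)
      then have "i = r a b"
        using inv_into_f_f[OF inj i] by (simp add: r_def)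
      moreover have "a \<in> {1..4}" "b \<in> {1..4}"
        using ab(1) sub[of i] by simp_all
      ultimately show ?thesis
        using ab(2) by blast
    qed
  qed
  then show thesis by (rule that)
qed

lemma isomorphic_G64_card:
  assumes "isomorphic 6 4 G64 G"
  shows "card (two_edges G) \<le> 4"
proof -
  obtain \<phi> where "(\<lambda>e. \<phi> ` e) ` two_edges G64 = two_edges G"
    using assms unfolding isomorphic_def by blast
  then show ?thesis
    using card_image_le[of "two_edges G64" "\<lambda>e. \<phi> ` e"] card_G64(2)
      configuration_finite[OF configuration_G64] by simp
qed

text \<open>Assuming \<open>16 \<le> R_config G\<close> rather than equality serves both uniqueness
  and the upper bound for \<open>z2 6 4\<close>.\<close>

lemma irreducible_limited_isomorphic_G64:
  assumes "irreducible_config 6 4 G" "limited 6 4 G" "16 \<le> R_config G"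
  shows "isomorphic 6 4 G64 G"
proof -
  obtain r where "k4_labelling G r"
    using limited_64_labelling assms(1,2) by blast
  moreover have "card (one_edges G) = 12"
    using assms(2) by (simp add: limited_def z_C4_64)
  ultimately show ?thesis
    using k4_labelling.isomorphic_G64 assms(3) by (simp add: R_config_def)
qed

text \<open>A larger configuration would still be isomorphic to \<open>G64\<close>, which has only
  four two-edges.\<close>

lemma irreducible_limited_R_le:
  assumes "irreducible_config 6 4 G" "limited 6 4 G"
  shows "R_config G \<le> 16"
proof (rule ccontr)
  assume "\<not> R_config G \<le> 16"
  then have "card (two_edges G) \<le> 4"
    using irreducible_limited_isomorphic_G64[OF assms] isomorphic_G64_card by simp
  then show False
    using assms(2) \<open>\<not> R_config G \<le> 16\<close> by (simp add: limited_def z_C4_64 R_config_def)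
qed

lemma z2_64: "z2 6 4 = 16"
  unfolding z2_def
proof (rule Max_eqI)
  show "finite {R_config G |G. irreducible_config 6 4 G \<and> limited 6 4 G}"
    by (rule finite_subset[of _ "{..16}"]) (auto simp: irreducible_limited_R_le)
  show "k \<le> 16" if "k \<in> {R_config G |G. irreducible_config 6 4 G \<and> limited 6 4 G}" for k
    using that by (auto simp: irreducible_limited_R_le)
  show "16 \<in> {R_config G |G. irreducible_config 6 4 G \<and> limited 6 4 G}"
    using irreducible_G64 limited_G64 by (force simp: R_config_def card_G64)
qed

theorem theorem4p1:
  shows "z2 6 4 = 16 \<and>
    irreducible_config 6 4 G64 \<and> limited 6 4 G64 \<and> R_config G64 = z2 6 4 \<and>
    unoccupied 6 4 G64 = {(1, 4), (3, 3), (4, 1), (6, 2)} \<and>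
    (\<forall>G. irreducible_config 6 4 G \<and> limited 6 4 G \<and> R_config G = z2 6 4 \<longrightarrow> isomorphic 6 4 G64 G)"
  using irreducible_G64 limited_G64 unoccupied_G64 irreducible_limited_isomorphic_G64
  by (simp add: z2_64 R_config_def card_G64)

end
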